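(* Let $E$ be a Banach space and $F$ a Banach lattice with dual $F'$. Then the following hold. (1) For a continuous (linear) operator $T:E\to F$, the following conditions are equivalent. (a) $T$ is L-weakly compact. (b) $y'_n(Tx_n)\to 0$ for each sequence $(x_n)$ in $B_E$ and every bounded $uaw^*$-null sequence $(y'_n)$ in $F'$. (c) $y'_n(Tx_n)\to 0$ for each sequence $(x_n)$ in $B_E$ and every bounded $uaw$-null sequence $(y'_n)$ in $F'$. (d) $y'_n(Tx_n)\to 0$ for each sequence $(x_n)$ in $B_E$ and every bounded $uo$-null sequence $(y'_n)$ in $F'$. (2) A continuous (linear) operator $S:E\to F'$ is L-weakly compact if and only if $(Sx_n)(y_n)\to 0$ for each sequence $(x_n)$ in $B_E$ and every bounded $uaw$-null sequence $(y_n)$ in $F$.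
   Context: $B_E$ is the closed unit ball of $E$. A bounded subset $A$ of a Banach lattice is L-weakly compact if every disjoint sequence in the solid hull of $A$ converges to zero in norm (a sequence $(x_n)$ is disjoint if $|x_n|\wedge|x_m|=0$ for $n\neq m$). A continuous operator $T$ from a Banach space $E$ to a Banach lattice $G$ is L-weakly compact if $T(B_E)$ is an L-weakly compact subset of $G$. A net $(x_\alpha)$ in a Riesz space is order convergent to $x$ if there is a net $(y_\beta)$, possibly over a different index set, with $y_\beta\downarrow 0$ such that for each $\beta$ there is $\alpha_0$ with $|x_\alpha-x|\le y_\beta$ for all $\alpha\ge\alpha_0$. In a Banach lattice $G$, a net $(x_\alpha)$ is $uo$-convergent (unbounded order convergent), respectively $uaw$-convergent (unbounded absolute weakly convergent), to $x$ if for every $u\in G_+$ the net $|x_\alpha-x|\wedge u$ converges to $0$ in order, respectively weakly, i.e. in $\sigma(G,G')$. In a dual Banach lattice $F'$, a net $(y'_\alpha)$ is $uaw^*$-convergent (unbounded absolute weak* convergent) to $y'$ if $|y'_\alpha-y'|\wedge u'\to 0$ in $\sigma(F',F)$ for every $u'\in F'_+$. A sequence is $uo$-, $uaw$- or $uaw^*$-null if it converges to $0$ in the respective sense. "Bounded" means norm bounded. *)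

theory Defs
  imports "HOL-Analysis.Analysis" "HOL-Library.Lattice_Algebras"
begin

section \<open>Banach lattices\<close>

class banach_lattice = banach + ordered_real_vector + lattice_ab_group_add_abs +
  assumes norm_mono_abs: "\<bar>x\<bar> \<le> \<bar>y\<bar> \<Longrightarrow> norm x \<le> norm y"

text \<open>The bounded operators into a Banach lattice do not in general form a lattice, so the
  order structure on \<^typ>\<open>'a \<Rightarrow>\<^sub>L real\<close> is set up for codomains that are
  totally ordered and conditionally complete. The only use made of it is the codomain
  \<^typ>\<open>real\<close>, i.e. the dual of a Banach lattice.\<close>

class complete_linear_banach_lattice = banach_lattice + conditionally_complete_linorder

instance real :: complete_linear_banach_lattice
  by standard auto

lemma norm_abs_eq [simp]: "norm \<bar>x\<bar> = norm x" for x :: "'a::banach_lattice"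
  by (intro antisym norm_mono_abs) auto

lemma norm_mono_nonneg: "0 \<le> x \<Longrightarrow> x \<le> y \<Longrightarrow> norm x \<le> norm y" for x :: "'a::banach_lattice"
  by (rule norm_mono_abs) (auto simp: abs_of_nonneg)

lemma riesz_decomposition:
  fixes x y z :: "'a::banach_lattice"
  assumes "0 \<le> x" "0 \<le> y" "0 \<le> z" "z \<le> x + y"
  obtains a b where "z = a + b" "0 \<le> a" "a \<le> x" "0 \<le> b" "b \<le> y"
proof
  show "z = inf z x + (z - inf z x)" by (metis add.commute diff_add_cancel)
  show "0 \<le> inf z x" "inf z x \<le> x" using assms by auto
  show "0 \<le> z - inf z x" by (simp only: diff_ge_0_iff_ge inf_le1)
  have "z - inf z x = sup 0 (z - x)"
    by (simp add: diff_inf_eq_sup add_sup_distrib_left)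
  also have "\<dots> \<le> y" using assms by (simp add: algebra_simps)
  finally show "z - inf z x \<le> y" .
qed

lemma linear_cone_extension:
  fixes p :: "'a::banach_lattice \<Rightarrow> 'b::real_vector"
  assumes add: "\<And>x y. 0 \<le> x \<Longrightarrow> 0 \<le> y \<Longrightarrow> p (x + y) = p x + p y"
    and scale: "\<And>c x. 0 \<le> c \<Longrightarrow> 0 \<le> x \<Longrightarrow> p (c *\<^sub>R x) = c *\<^sub>R p x"
  shows "linear (\<lambda>x. p (pprt x) - p (- nprt x))"
proof -
  define P where "P = (\<lambda>x. p (pprt x) - p (- nprt x))"
  have key: "P (a - b) = p a - p b" if "0 \<le> a" "0 \<le> b" for a b
  proof -
    have "pprt (a - b) + b = a + (- nprt (a - b))"
      using prts[of "a - b"] by (simp add: algebra_simps)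
    then have "p (pprt (a - b) + b) = p (a + (- nprt (a - b)))" by simp
    then have "p (pprt (a - b)) + p b = p a + p (- nprt (a - b))"
      using that by (subst (asm) (1 2) add) auto
    then show ?thesis by (simp add: P_def algebra_simps)
  qed
  have dec: "x = pprt x - (- nprt x)" for x :: 'a using prts[of x] by simp
  have "P (x + y) = P x + P y" for x y
  proof -
    have "x + y = (pprt x + pprt y) - ((- nprt x) + (- nprt y))"
      using arg_cong2[OF dec[of x] dec[of y], of "(+)"] by (simp only: algebra_simps)
    then have "P (x + y) = p (pprt x + pprt y) - p ((- nprt x) + (- nprt y))"
      by (metis key add_nonneg_nonneg zero_le_pprt neg_0_le_iff_le nprt_le_zero)
    also have "\<dots> = P x + P y"
      by (subst (1 2) add) (auto simp: P_def)
    finally show ?thesis .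
  qed
  moreover have "P (c *\<^sub>R x) = c *\<^sub>R P x" for c x
  proof (cases "0 \<le> c")
    case True
    have "c *\<^sub>R x = c *\<^sub>R pprt x - c *\<^sub>R (- nprt x)"
      by (metis dec scaleR_right_diff_distrib)
    then have "P (c *\<^sub>R x) = p (c *\<^sub>R pprt x) - p (c *\<^sub>R (- nprt x))"
      using True by (metis key scaleR_nonneg_nonneg zero_le_pprt neg_0_le_iff_le nprt_le_zero)
    then show ?thesis using True by (simp add: scale P_def scaleR_right_diff_distrib flip: scaleR_minus_right)
  next
    case False
    then have c: "0 \<le> - c" by simp
    have "c *\<^sub>R x = (- c) *\<^sub>R (- nprt x) - (- c) *\<^sub>R pprt x"
      by (subst dec[of x]) (simp add: algebra_simps)
    then have "P (c *\<^sub>R x) = p ((- c) *\<^sub>R (- nprt x)) - p ((- c) *\<^sub>R pprt x)"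
      using c by (metis key scaleR_nonneg_nonneg zero_le_pprt neg_0_le_iff_le nprt_le_zero)
    also have "\<dots> = (- c) *\<^sub>R p (- nprt x) - (- c) *\<^sub>R p (pprt x)"
      using c scale[of "- c" "- nprt x"] scale[of "- c" "pprt x"] by simp
    finally show ?thesis by (simp add: P_def algebra_simps)
  qed
  ultimately show ?thesis unfolding P_def by (intro linearI) auto
qed

lemma linear_eq_on_cone:
  fixes f g :: "'a::banach_lattice \<Rightarrow>\<^sub>L 'b::real_normed_vector"
  assumes "\<And>x. 0 \<le> x \<Longrightarrow> f x = g x"
  shows "f = g"
proof (rule blinfun_eqI)
  fix x
  have "f (pprt x) = g (pprt x)" "f (- nprt x) = g (- nprt x)"
    by (auto intro!: assms)
  then show "f x = g x"
    by (subst (1 2) prts[of x]) (simp add: blinfun.bilinear_simps)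
qed

lemma norm_pprt_le: "norm (pprt x) \<le> norm x" for x :: "'a::banach_lattice"
proof (rule norm_mono_abs)
  show "\<bar>pprt x\<bar> \<le> \<bar>x\<bar>"
    using abs_prts[of x] by (simp add: abs_of_nonneg)
qed

lemma norm_nprt_le: "norm (nprt x) \<le> norm x" for x :: "'a::banach_lattice"
proof (rule norm_mono_abs)
  show "\<bar>nprt x\<bar> \<le> \<bar>x\<bar>"
    using abs_prts[of x] by (simp add: abs_of_nonpos)
qed

lemma le_of_norm_le_lin:
  fixes v :: "'b::complete_linear_banach_lattice"
  assumes "0 \<le> v" and S: "S \<noteq> {}" "\<And>s. s \<in> S \<Longrightarrow> norm s \<le> c"
    and least: "\<And>w. (\<And>s. s \<in> S \<Longrightarrow> s \<le> w) \<Longrightarrow> v \<le> w"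
  shows "norm v \<le> c"
proof (rule ccontr)
  assume "\<not> norm v \<le> c"
  then have lt: "c < norm v" by simp
  obtain s0 where "s0 \<in> S" using S by blast
  then have c0: "0 \<le> c" using S(2) norm_ge_zero order_trans by blast
  obtain d where d: "c < d" "d < norm v" using dense lt by blast
  define t where "t = (d / norm v) *\<^sub>R v"
  have "v \<noteq> 0" using d c0 by auto
  then have nt: "norm t = d" using d c0 by (simp add: t_def)
  have t0: "0 \<le> t" using assms(1) d c0 by (simp add: t_def scaleR_nonneg_nonneg)
  have "t \<le> 1 *\<^sub>R v" unfolding t_def
    using assms(1) d c0 by (intro scaleR_right_mono) (auto simp: divide_simps)
  moreover have "t \<noteq> v" using nt d by auto
  ultimately have "t < v" by simp
  then obtain s where s: "s \<in> S" "t < s" using least[of t] by (meson not_le)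
  then have "norm t \<le> norm s" using t0 by (intro norm_mono_nonneg) auto
  then show False using S(2)[OF s(1)] nt d by simp
qed

subsection \<open>The dual Banach lattice\<close>

instantiation blinfun :: (banach_lattice, complete_linear_banach_lattice) order
begin

definition less_eq_blinfun :: "'a \<Rightarrow>\<^sub>L 'b \<Rightarrow> 'a \<Rightarrow>\<^sub>L 'b \<Rightarrow> bool"
  where "f \<le> g \<longleftrightarrow> (\<forall>x\<ge>0. blinfun_apply f x \<le> blinfun_apply g x)"

definition less_blinfun :: "'a \<Rightarrow>\<^sub>L 'b \<Rightarrow> 'a \<Rightarrow>\<^sub>L 'b \<Rightarrow> bool"
  where "f < g \<longleftrightarrow> f \<le> g \<and> \<not> g \<le> (f :: 'a \<Rightarrow>\<^sub>L 'b)"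

instance
proof
  fix f g h :: "'a \<Rightarrow>\<^sub>L 'b"
  show "f \<le> g \<Longrightarrow> g \<le> f \<Longrightarrow> f = g"
    by (auto simp: less_eq_blinfun_def intro!: linear_eq_on_cone antisym)
qed (auto simp: less_eq_blinfun_def less_blinfun_def intro: order_trans)

end

instance blinfun :: (banach_lattice, complete_linear_banach_lattice) ordered_real_vector
  by standard
    (auto simp: less_eq_blinfun_def blinfun.bilinear_simps intro: scaleR_left_mono,
      metis blinfun.zero_left scaleR_right_mono)

text \<open>Riesz--Kantorovich formula for the positive part.\<close>

lemma blinfun_pos_part_exists:
  fixes f :: "'a::banach_lattice \<Rightarrow>\<^sub>L 'b::complete_linear_banach_lattice"
  obtains h where "\<And>x. 0 \<le> x \<Longrightarrow> bdd_above (blinfun_apply f ` {0..x})"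
    and "\<And>x. 0 \<le> x \<Longrightarrow> blinfun_apply h x = Sup (blinfun_apply f ` {0..x})"
    and "f \<le> h" "0 \<le> h" "\<And>k. f \<le> k \<Longrightarrow> 0 \<le> k \<Longrightarrow> h \<le> k"
proof -
  define p where "p = (\<lambda>x. Sup (blinfun_apply f ` {0..x}))"
  have nle: "norm (f y) \<le> norm f * norm x" if "0 \<le> y" "y \<le> x" for x y
    by (meson norm_blinfun norm_mono_nonneg that mult_left_mono norm_ge_zero order_trans)
  have bdd: "bdd_above (blinfun_apply f ` {0..x})" for x
  proof (cases "\<exists>e::'b. e \<noteq> 0")
    case True
    then obtain e :: 'b where e: "e \<noteq> 0" by blast
    define d where "d = ((norm f * norm x + 1) / norm e) *\<^sub>R \<bar>e\<bar>"
    have "0 \<le> norm f * norm x" by simp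
    then have nd: "norm d = norm f * norm x + 1"
      using e by (simp add: d_def)
    have d0: "0 \<le> d" by (simp add: d_def scaleR_nonneg_nonneg)
    show ?thesis
    proof (rule bdd_aboveI2)
      fix y assume "y \<in> {0..x}"
      then have "norm (f y) \<le> norm f * norm x" using nle by auto
      then have "norm (f y) < norm d" using nd by simp
      then show "f y \<le> d" using norm_mono_nonneg[OF d0, of "f y"]
        by (meson linear not_le)
    qed
  next
    case False
    then have "f y \<le> 0" for y by (metis order_refl)
    then show ?thesis by (intro bdd_aboveI2[where M = 0])
  qed
  have ne: "blinfun_apply f ` {0..x} \<noteq> {}" if "0 \<le> x" for x using that by auto
  have up: "f y \<le> p x" if "0 \<le> y" "y \<le> x" for x y
    unfolding p_def using that by (intro cSup_upper bdd) auto
  have least: "p x \<le> w" if "0 \<le> x" "\<And>y. 0 \<le> y \<Longrightarrow> y \<le> x \<Longrightarrow> f y \<le> w" for x w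
    unfolding p_def using that by (intro cSup_least ne) auto
  have p0: "p 0 = 0"
    using up[of 0 0] by (intro antisym least) (auto simp: blinfun.zero_right dest: antisym)
  have pnonneg: "0 \<le> p x" if "0 \<le> x" for x
    using up[of 0 x] that by (simp add: blinfun.zero_right)
  have add: "p (x + y) = p x + p y" if xy: "0 \<le> x" "0 \<le> y" for x y
  proof (rule antisym)
    show "p (x + y) \<le> p x + p y"
    proof (rule least)
      show "0 \<le> x + y" using xy by simp
      fix z assume "0 \<le> z" "z \<le> x + y"
      with xy obtain a b where "z = a + b" "0 \<le> a" "a \<le> x" "0 \<le> b" "b \<le> y"
        by (rule riesz_decomposition)
      then show "f z \<le> p x + p y"
        by (auto simp: blinfun.add_right intro!: add_mono up)
    qed
    have "p x \<le> p (x + y) - p y"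
    proof (rule least[OF xy(1)])
      fix a assume a: "0 \<le> a" "a \<le> x"
      have "p y \<le> p (x + y) - f a"
      proof (rule least[OF xy(2)])
        fix b assume b: "0 \<le> b" "b \<le> y"
        have "f (a + b) \<le> p (x + y)"
          using a b by (intro up add_nonneg_nonneg add_mono) auto
        then show "f b \<le> p (x + y) - f a" by (simp add: blinfun.add_right algebra_simps)
      qed
      then show "f a \<le> p (x + y) - p y" by (simp add: algebra_simps)
    qed
    then show "p x + p y \<le> p (x + y)" by (simp add: algebra_simps)
  qed
  have scale_le: "p (c *\<^sub>R x) \<le> c *\<^sub>R p x" if c: "0 < c" and x: "0 \<le> x" for c x
  proof (rule least)
    show "0 \<le> c *\<^sub>R x" using c x by (simp add: scaleR_nonneg_nonneg)
    fix y assume y: "0 \<le> y" "y \<le> c *\<^sub>R x"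
    have "inverse c *\<^sub>R y \<le> inverse c *\<^sub>R (c *\<^sub>R x)"
      using y c by (intro scaleR_left_mono) auto
    then have "f (inverse c *\<^sub>R y) \<le> p x"
      using y c by (intro up scaleR_nonneg_nonneg) auto
    then have "c *\<^sub>R f (inverse c *\<^sub>R y) \<le> c *\<^sub>R p x"
      using c by (intro scaleR_left_mono) auto
    then show "f y \<le> c *\<^sub>R p x" using c by (simp add: blinfun.scaleR_right)
  qed
  have scale: "p (c *\<^sub>R x) = c *\<^sub>R p x" if c: "0 \<le> c" and x: "0 \<le> x" for c x
  proof (cases "c = 0")
    case True
    then show ?thesis by (simp add: p0)
  next
    case False
    then have c: "0 < c" using c by simp
    have "p (inverse c *\<^sub>R (c *\<^sub>R x)) \<le> inverse c *\<^sub>R p (c *\<^sub>R x)"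
      using c x by (intro scale_le scaleR_nonneg_nonneg) auto
    then have "c *\<^sub>R p x \<le> c *\<^sub>R (inverse c *\<^sub>R p (c *\<^sub>R x))"
      using c by (intro scaleR_left_mono) auto
    then show ?thesis using c scale_le[OF c x] by (intro antisym) auto
  qed
  have pn: "norm (p x) \<le> norm f * norm x" if "0 \<le> x" for x
    by (rule le_of_norm_le_lin[where S = "blinfun_apply f ` {0..x}"])
      (use that in \<open>auto intro: pnonneg nle least\<close>)
  define P where "P = (\<lambda>x. p (pprt x) - p (- nprt x))"
  have "linear P" unfolding P_def by (rule linear_cone_extension[OF add scale])
  moreover have "norm (P x) \<le> norm x * (2 * norm f)" for x
  proof -
    have "norm (P x) \<le> norm (p (pprt x)) + norm (p (- nprt x))"
      unfolding P_def by (rule norm_triangle_ineq4)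
    also have "\<dots> \<le> norm f * norm (pprt x) + norm f * norm (- nprt x)"
      by (intro add_mono pn) auto
    also have "\<dots> \<le> norm f * norm x + norm f * norm x"
      by (intro add_mono mult_left_mono) (auto simp: norm_pprt_le norm_nprt_le)
    finally show ?thesis by (simp add: algebra_simps)
  qed
  ultimately have "bounded_linear P"
    by (intro bounded_linear.intro) (auto simp: bounded_linear_axioms_def)
  then have hP: "blinfun_apply (Blinfun P) x = P x" for x
    by (simp add: bounded_linear_Blinfun_apply)
  have hp: "blinfun_apply (Blinfun P) x = p x" if "0 \<le> x" for x
    unfolding hP using that by (simp add: P_def p0)
  show ?thesis
  proof (rule that[of "Blinfun P"])
    show "bdd_above (blinfun_apply f ` {0..x})" for x by (rule bdd)
    show "blinfun_apply (Blinfun P) x = Sup (blinfun_apply f ` {0..x})" if "0 \<le> x" for x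
      using hp[OF that] by (simp add: p_def)
    show "f \<le> Blinfun P" by (auto simp: less_eq_blinfun_def hp up)
    show "0 \<le> Blinfun P" by (auto simp: less_eq_blinfun_def hp pnonneg)
    fix k assume k: "f \<le> k" "0 \<le> k"
    show "Blinfun P \<le> k"
      unfolding less_eq_blinfun_def
    proof (intro allI impI)
      fix x :: 'a assume x: "0 \<le> x"
      show "blinfun_apply (Blinfun P) x \<le> k x"
        unfolding hp[OF x]
      proof (rule least[OF x])
        fix y assume y: "0 \<le> y" "y \<le> x"
        have "f y \<le> k y" using k(1) y by (simp add: less_eq_blinfun_def)
        also have "k y \<le> k x"
          using k(2) y unfolding less_eq_blinfun_def
          by (metis blinfun.diff_right blinfun.zero_left diff_ge_0_iff_ge)
        finally show "f y \<le> k x" .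
      qed
    qed
  qed
qed

instantiation blinfun :: (banach_lattice, complete_linear_banach_lattice) lattice_ab_group_add_abs
begin

definition sup_blinfun :: "'a \<Rightarrow>\<^sub>L 'b \<Rightarrow> 'a \<Rightarrow>\<^sub>L 'b \<Rightarrow> 'a \<Rightarrow>\<^sub>L 'b"
  where "sup f g = (THE h :: 'a \<Rightarrow>\<^sub>L 'b. f \<le> h \<and> g \<le> h \<and> (\<forall>k. f \<le> k \<longrightarrow> g \<le> k \<longrightarrow> h \<le> k))"

definition inf_blinfun :: "'a \<Rightarrow>\<^sub>L 'b \<Rightarrow> 'a \<Rightarrow>\<^sub>L 'b \<Rightarrow> 'a \<Rightarrow>\<^sub>L 'b"
  where "inf f g = - sup (- f) (- g :: 'a \<Rightarrow>\<^sub>L 'b)"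

definition abs_blinfun :: "'a \<Rightarrow>\<^sub>L 'b \<Rightarrow> 'a \<Rightarrow>\<^sub>L 'b"
  where "\<bar>f\<bar> = sup f (- f :: 'a \<Rightarrow>\<^sub>L 'b)"

instance
proof
  have *: "f \<le> sup f g \<and> g \<le> sup f g \<and> (\<forall>k. f \<le> k \<longrightarrow> g \<le> k \<longrightarrow> sup f g \<le> k)"
    for f g :: "'a \<Rightarrow>\<^sub>L 'b"
    unfolding sup_blinfun_def
  proof (rule theI')
    obtain h where h: "f - g \<le> h" "0 \<le> h" "\<And>k. f - g \<le> k \<Longrightarrow> 0 \<le> k \<Longrightarrow> h \<le> k"
      using blinfun_pos_part_exists[of "f - g"] by metis
    have "f \<le> h + g" "g \<le> h + g" using h(1,2) by (simp_all add: algebra_simps)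
    moreover have "h + g \<le> k" if "f \<le> k" "g \<le> k" for k
      using h(3)[of "k - g"] that by (simp add: algebra_simps)
    ultimately show "\<exists>!h. f \<le> h \<and> g \<le> h \<and> (\<forall>k. f \<le> k \<longrightarrow> g \<le> k \<longrightarrow> h \<le> k)"
      by (intro ex1I[of _ "h + g"]) (auto intro: antisym)
  qed
  fix f g h :: "'a \<Rightarrow>\<^sub>L 'b"
  show "f \<le> sup f g" "g \<le> sup f g" using *[of f g] by auto
  show "f \<le> h \<Longrightarrow> g \<le> h \<Longrightarrow> sup f g \<le> h" using *[of f g] by auto
  have neg: "- a \<le> b \<longleftrightarrow> - b \<le> a" for a b :: "'a \<Rightarrow>\<^sub>L 'b"
    by (rule minus_le_iff)
  show "inf f g \<le> f" "inf f g \<le> g"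
    unfolding inf_blinfun_def using *[of "- f" "- g"] by (auto simp: neg)
  show "h \<le> f \<Longrightarrow> h \<le> g \<Longrightarrow> h \<le> inf f g"
    unfolding inf_blinfun_def using *[of "- f" "- g"]
    by (metis le_minus_iff minus_le_iff neg_le_iff_le)
  show "\<bar>f\<bar> = sup f (- f)" by (rule abs_blinfun_def)
qed

end

lemma blinfun_sup_0:
  fixes f :: "'a::banach_lattice \<Rightarrow>\<^sub>L 'b::complete_linear_banach_lattice"
  assumes "0 \<le> x"
  shows "blinfun_apply (sup f 0) x = Sup (blinfun_apply f ` {0..x})"
    and "bdd_above (blinfun_apply f ` {0..x})"
proof -
  obtain h where h: "\<And>x. 0 \<le> x \<Longrightarrow> bdd_above (blinfun_apply f ` {0..x})"
    "\<And>x. 0 \<le> x \<Longrightarrow> blinfun_apply h x = Sup (blinfun_apply f ` {0..x})"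
    "f \<le> h" "0 \<le> h" "\<And>k. f \<le> k \<Longrightarrow> 0 \<le> k \<Longrightarrow> h \<le> k"
    using blinfun_pos_part_exists[of f] by metis
  have "sup f 0 = h" using h(3-5) by (intro antisym) auto
  then show "blinfun_apply (sup f 0) x = Sup (blinfun_apply f ` {0..x})"
    "bdd_above (blinfun_apply f ` {0..x})"
    using h assms by auto
qed

lemma blinfun_abs_apply_le:
  fixes f :: "'a::banach_lattice \<Rightarrow>\<^sub>L 'b::complete_linear_banach_lattice"
  shows "\<bar>blinfun_apply f x\<bar> \<le> blinfun_apply \<bar>f\<bar> \<bar>x\<bar>"
proof -
  have le: "blinfun_apply f y \<le> blinfun_apply \<bar>f\<bar> y" "- blinfun_apply f y \<le> blinfun_apply \<bar>f\<bar> y"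
    if "0 \<le> y" for y
    using abs_ge_self[of f] abs_ge_minus_self[of f] that
    by (auto simp: less_eq_blinfun_def blinfun.minus_left)
  have x: "x = pprt x - (- nprt x)" using prts[of x] by simp
  have ax: "\<bar>x\<bar> = pprt x + (- nprt x)" using abs_prts[of x] by simp
  have "blinfun_apply f x = blinfun_apply f (pprt x) - blinfun_apply f (- nprt x)"
    by (subst x) (simp only: blinfun.diff_right)
  moreover have "blinfun_apply \<bar>f\<bar> \<bar>x\<bar> = blinfun_apply \<bar>f\<bar> (pprt x) + blinfun_apply \<bar>f\<bar> (- nprt x)"
    by (subst ax) (simp only: blinfun.add_right)
  moreover have "blinfun_apply f (pprt x) - blinfun_apply f (- nprt x)
      \<le> blinfun_apply \<bar>f\<bar> (pprt x) + blinfun_apply \<bar>f\<bar> (- nprt x)"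
    using add_mono[OF le(1)[of "pprt x"] le(2)[of "- nprt x"]] by simp
  moreover have "- (blinfun_apply f (pprt x) - blinfun_apply f (- nprt x))
      \<le> blinfun_apply \<bar>f\<bar> (pprt x) + blinfun_apply \<bar>f\<bar> (- nprt x)"
    using add_mono[OF le(2)[of "pprt x"] le(1)[of "- nprt x"]] by simp
  ultimately show ?thesis by (metis abs_le_iff)
qed

lemma blinfun_abs_least:
  fixes f :: "'a::banach_lattice \<Rightarrow>\<^sub>L 'b::complete_linear_banach_lattice"
  assumes x: "0 \<le> x" and w: "\<And>y. \<bar>y\<bar> \<le> x \<Longrightarrow> blinfun_apply f y \<le> w"
  shows "blinfun_apply \<bar>f\<bar> x \<le> w"
proof -
  have "\<bar>f\<bar> = sup (2 *\<^sub>R f) 0 - f"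
  proof -
    have "sup f (- f) + f = sup (f + f) (- f + f)" by (rule add_sup_distrib_right)
    then show ?thesis by (simp add: abs_lattice scaleR_2 algebra_simps)
  qed
  then have "blinfun_apply \<bar>f\<bar> x = Sup (blinfun_apply (2 *\<^sub>R f) ` {0..x}) - blinfun_apply f x"
    by (simp only: blinfun.diff_left blinfun_sup_0(1)[OF x])
  also have "\<dots> \<le> (w + blinfun_apply f x) - blinfun_apply f x"
  proof (intro diff_right_mono cSup_least)
    show "blinfun_apply (2 *\<^sub>R f) ` {0..x} \<noteq> {}" using x by auto
    fix z assume "z \<in> blinfun_apply (2 *\<^sub>R f) ` {0..x}"
    then obtain y where y: "0 \<le> y" "y \<le> x" and z: "z = blinfun_apply (2 *\<^sub>R f) y" by auto
    have "y + y - x \<le> x"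
      using add_mono[OF y(2) y(2)] by (simp add: algebra_simps)
    moreover have "- (y + y - x) \<le> x"
      using order_trans[of "- y" 0 y] y(1) by simp
    ultimately have "\<bar>y + y - x\<bar> \<le> x" by (rule abs_leI)
    from w[OF this] show "z \<le> w + blinfun_apply f x"
      by (simp add: z blinfun.bilinear_simps scaleR_2 algebra_simps)
  qed
  finally show ?thesis by simp
qed

instance blinfun :: (banach_lattice, complete_linear_banach_lattice) banach_lattice
proof
  fix f g :: "'a \<Rightarrow>\<^sub>L 'b"
  assume fg: "\<bar>f\<bar> \<le> \<bar>g\<bar>"
  show "norm f \<le> norm g"
  proof (rule norm_blinfun_bound)
    fix x
    have "norm (f x) \<le> norm (blinfun_apply \<bar>g\<bar> \<bar>x\<bar>)"
    proof (rule norm_mono_abs)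
      have "\<bar>f x\<bar> \<le> blinfun_apply \<bar>f\<bar> \<bar>x\<bar>" by (rule blinfun_abs_apply_le)
      also have "\<dots> \<le> blinfun_apply \<bar>g\<bar> \<bar>x\<bar>" using fg by (simp add: less_eq_blinfun_def)
      also have "\<dots> \<le> \<bar>blinfun_apply \<bar>g\<bar> \<bar>x\<bar>\<bar>" by (rule abs_ge_self)
      finally show "\<bar>f x\<bar> \<le> \<bar>blinfun_apply \<bar>g\<bar> \<bar>x\<bar>\<bar>" .
    qed
    also have "\<dots> \<le> norm g * norm x"
    proof (rule le_of_norm_le_lin[where S = "blinfun_apply g ` {y. \<bar>y\<bar> \<le> \<bar>x\<bar>}"])
      show "0 \<le> blinfun_apply \<bar>g\<bar> \<bar>x\<bar>"
        using abs_ge_zero[of g] unfolding less_eq_blinfun_def by simp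
      fix s assume "s \<in> blinfun_apply g ` {y. \<bar>y\<bar> \<le> \<bar>x\<bar>}"
      then obtain y where y: "s = g y" "\<bar>y\<bar> \<le> \<bar>x\<bar>" by auto
      show "norm s \<le> norm g * norm x"
        unfolding y(1)
        by (meson norm_blinfun norm_mono_abs y(2) mult_left_mono norm_ge_zero order_trans)
    next
      fix w assume "\<And>s. s \<in> blinfun_apply g ` {y. \<bar>y\<bar> \<le> \<bar>x\<bar>} \<Longrightarrow> s \<le> w"
      then show "blinfun_apply \<bar>g\<bar> \<bar>x\<bar> \<le> w" by (intro blinfun_abs_least) auto
    qed auto
    finally show "norm (f x) \<le> norm g * norm x" .
  qed simp
qed

section \<open>L-weak compactness\<close>

definition solid_hull :: "'a::banach_lattice set \<Rightarrow> 'a set"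
  where "solid_hull A = {x. \<exists>a\<in>A. \<bar>x\<bar> \<le> \<bar>a\<bar>}"

definition disjoint_seq :: "(nat \<Rightarrow> 'a::banach_lattice) \<Rightarrow> bool"
  where "disjoint_seq x \<longleftrightarrow> (\<forall>m n. m \<noteq> n \<longrightarrow> inf \<bar>x m\<bar> \<bar>x n\<bar> = 0)"

definition L_weakly_compact :: "'a::banach_lattice set \<Rightarrow> bool"
  where "L_weakly_compact A \<longleftrightarrow>
    bounded A \<and> (\<forall>x. disjoint_seq x \<and> range x \<subseteq> solid_hull A \<longrightarrow> x \<longlonglongrightarrow> 0)"

definition L_weakly_compact_operator :: "('e::banach \<Rightarrow>\<^sub>L 'a::banach_lattice) \<Rightarrow> bool"
  where "L_weakly_compact_operator T \<longleftrightarrow> L_weakly_compact (blinfun_apply T ` cball 0 1)"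

section \<open>Unbounded convergence\<close>

text \<open>Nets are rendered as usual by a function together with a filter on its index type. The
  auxiliary decreasing net in order convergence needs an actual index set: a nonempty set \<open>J\<close>
  with a directed preorder \<open>r\<close>.\<close>

definition directed_index :: "'j set \<Rightarrow> ('j \<Rightarrow> 'j \<Rightarrow> bool) \<Rightarrow> bool"
  where "directed_index J r \<longleftrightarrow> J \<noteq> {} \<and> (\<forall>i\<in>J. r i i) \<and>
    (\<forall>i\<in>J. \<forall>j\<in>J. \<forall>k\<in>J. r i j \<longrightarrow> r j k \<longrightarrow> r i k) \<and>
    (\<forall>i\<in>J. \<forall>j\<in>J. \<exists>k\<in>J. r i k \<and> r j k)"

definition decreases_to_zero :: "'j set \<Rightarrow> ('j \<Rightarrow> 'j \<Rightarrow> bool) \<Rightarrow> ('j \<Rightarrow> 'a::banach_lattice) \<Rightarrow> bool"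
  where "decreases_to_zero J r y \<longleftrightarrow> directed_index J r \<and>
    (\<forall>i\<in>J. \<forall>j\<in>J. r i j \<longrightarrow> y j \<le> y i) \<and>
    (\<forall>i\<in>J. 0 \<le> y i) \<and> (\<forall>z. (\<forall>i\<in>J. z \<le> y i) \<longrightarrow> z \<le> 0)"

text \<open>A definition cannot quantify over the index type of the decreasing net. Its index set is
  therefore taken inside \<^typ>\<open>'a\<close>; by \<open>order_convergentI\<close> below this is no restriction.\<close>

definition order_convergent :: "('i \<Rightarrow> 'a::banach_lattice) \<Rightarrow> 'a \<Rightarrow> 'i filter \<Rightarrow> bool"
  where "order_convergent x l F \<longleftrightarrow>
    (\<exists>(J::'a set) r y. decreases_to_zero J r y \<and>
      (\<forall>j\<in>J. eventually (\<lambda>i. \<bar>x i - l\<bar> \<le> y j) F))"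

lemma order_convergentI:
  fixes x :: "'i \<Rightarrow> 'a::banach_lattice" and J :: "'j set"
  assumes y: "decreases_to_zero J r y"
    and ev: "\<And>j. j \<in> J \<Longrightarrow> eventually (\<lambda>i. \<bar>x i - l\<bar> \<le> y j) F"
  shows "order_convergent x l F"
proof -
  have "directed_index (y ` J) (\<ge>)"
    unfolding directed_index_def
  proof (intro conjI ballI)
    show "y ` J \<noteq> {}" using y by (auto simp: decreases_to_zero_def directed_index_def)
    fix a b assume "a \<in> y ` J" "b \<in> y ` J"
    then obtain i j where ij: "i \<in> J" "j \<in> J" "a = y i" "b = y j" by auto
    then obtain k where "k \<in> J" "r i k" "r j k"
      using y unfolding decreases_to_zero_def directed_index_def by meson
    then show "\<exists>c\<in>y ` J. c \<le> a \<and> c \<le> b"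
      using y ij unfolding decreases_to_zero_def by blast
  qed auto
  then have "decreases_to_zero (y ` J) (\<ge>) (\<lambda>a. a)"
    using y by (auto simp: decreases_to_zero_def)
  then show ?thesis
    unfolding order_convergent_def using ev by blast
qed

definition weakly_convergent :: "('i \<Rightarrow> 'a::real_normed_vector) \<Rightarrow> 'a \<Rightarrow> 'i filter \<Rightarrow> bool"
  where "weakly_convergent x l F \<longleftrightarrow>
    (\<forall>\<phi> :: 'a \<Rightarrow>\<^sub>L real. ((\<lambda>i. \<phi> (x i)) \<longlongrightarrow> \<phi> l) F)"

definition weak_star_convergent ::
  "('i \<Rightarrow> 'a::real_normed_vector \<Rightarrow>\<^sub>L real) \<Rightarrow> ('a \<Rightarrow>\<^sub>L real) \<Rightarrow> 'i filter \<Rightarrow> bool"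
  where "weak_star_convergent f l F \<longleftrightarrow>
    (\<forall>v. ((\<lambda>i. blinfun_apply (f i) v) \<longlongrightarrow> blinfun_apply l v) F)"

definition uo_convergent :: "('i \<Rightarrow> 'a::banach_lattice) \<Rightarrow> 'a \<Rightarrow> 'i filter \<Rightarrow> bool"
  where "uo_convergent x l F \<longleftrightarrow> (\<forall>u\<ge>0. order_convergent (\<lambda>i. inf \<bar>x i - l\<bar> u) 0 F)"

definition uaw_convergent :: "('i \<Rightarrow> 'a::banach_lattice) \<Rightarrow> 'a \<Rightarrow> 'i filter \<Rightarrow> bool"
  where "uaw_convergent x l F \<longleftrightarrow> (\<forall>u\<ge>0. weakly_convergent (\<lambda>i. inf \<bar>x i - l\<bar> u) 0 F)"

definition uaw_star_convergent ::
  "('i \<Rightarrow> 'a::banach_lattice \<Rightarrow>\<^sub>L real) \<Rightarrow> ('a \<Rightarrow>\<^sub>L real) \<Rightarrow> 'i filter \<Rightarrow> bool"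
  where "uaw_star_convergent f l F \<longleftrightarrow>
    (\<forall>u\<ge>0. weak_star_convergent (\<lambda>i. inf \<bar>f i - l\<bar> u) 0 F)"

abbreviation uo_null_seq :: "(nat \<Rightarrow> 'a::banach_lattice) \<Rightarrow> bool"
  where "uo_null_seq x \<equiv> uo_convergent x 0 sequentially"

abbreviation uaw_null_seq :: "(nat \<Rightarrow> 'a::banach_lattice) \<Rightarrow> bool"
  where "uaw_null_seq x \<equiv> uaw_convergent x 0 sequentially"

abbreviation uaw_star_null_seq :: "(nat \<Rightarrow> 'a::banach_lattice \<Rightarrow>\<^sub>L real) \<Rightarrow> bool"
  where "uaw_star_null_seq f \<equiv> uaw_star_convergent f 0 sequentially"

end

theory Submission
  imports Defs
begin

text \<open>Everything rests on one statement about a bounded solid set \<open>B\<close> in a Banach lattice and a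
  bounded sequence of positive functionals \<open>f n\<close> with \<open>inf (f n) (f j) \<rightarrow> 0\<close> pointwise
  for each \<open>j\<close>: if \<open>\<rho> = (SUP n. f n)\<close> tends to \<open>0\<close> along disjoint sequences of \<open>B\<close>,
  then \<open>f n (b n) \<rightarrow> 0\<close> for all \<open>b n\<close> in \<open>B\<close>. A gliding hump shows that \<open>B\<close> is order
  bounded up to small \<open>\<rho>\<close>, which reduces the claim to a fixed element \<open>u\<close>; on \<open>[0, u]\<close> monotone
  sequences are \<open>\<rho>\<close>-Cauchy, and splitting \<open>u\<close> according to \<open>inf (f n) (f j)\<close> then rules
  out \<open>f n u \<ge> c > 0\<close>.

  If \<open>T\<close> is L-weakly compact, apply this to the solid hull of the image of the unit ball, with
  \<open>\<rho>\<close> dominated by the norm. Conversely, if it is not, there is a disjoint sequence \<open>v n\<close> in that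
  solid hull with norms bounded below; apply the statement to the \<open>v n\<close>, viewed as functionals on
  \<open>F'\<close> (for \<open>T\<close>) or on \<open>F\<close> (for \<open>S\<close>), and to the unit ball \<open>B\<close>. It yields a
  bounded disjoint sequence on which the operator does not tend to zero, and
  disjoint sequences are \<open>uaw\<close>-null and, in a dual lattice, \<open>uo\<close>-null.\<close>

section \<open>Banach lattices\<close>

lemma scaleR_inf:
  fixes x y :: "'a::banach_lattice"
  assumes "0 \<le> c"
  shows "c *\<^sub>R inf x y = inf (c *\<^sub>R x) (c *\<^sub>R y)"
proof (cases "c = 0")
  case False
  then have c: "0 < c" using assms by simp
  show ?thesis
  proof (rule antisym)
    show "c *\<^sub>R inf x y \<le> inf (c *\<^sub>R x) (c *\<^sub>R y)"
      using assms by (intro inf_greatest scaleR_left_mono) auto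
    have "inverse c *\<^sub>R inf (c *\<^sub>R x) (c *\<^sub>R y) \<le> inverse c *\<^sub>R (c *\<^sub>R x)"
      "inverse c *\<^sub>R inf (c *\<^sub>R x) (c *\<^sub>R y) \<le> inverse c *\<^sub>R (c *\<^sub>R y)"
      using c by (intro scaleR_left_mono; simp)+
    then have "inverse c *\<^sub>R inf (c *\<^sub>R x) (c *\<^sub>R y) \<le> inf x y"
      using c by simp
    then have "c *\<^sub>R (inverse c *\<^sub>R inf (c *\<^sub>R x) (c *\<^sub>R y)) \<le> c *\<^sub>R inf x y"
      using c by (intro scaleR_left_mono) auto
    then show "inf (c *\<^sub>R x) (c *\<^sub>R y) \<le> c *\<^sub>R inf x y" using c by simp
  qed
qed simp

lemma scaleR_pprt:
  fixes x :: "'a::banach_lattice"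
  assumes "0 \<le> c"
  shows "pprt (c *\<^sub>R x) = c *\<^sub>R pprt x"
proof -
  have *: "pprt y = - inf (- y) 0" for y :: 'a by (simp add: pprt_def)
  have "pprt (c *\<^sub>R x) = - (c *\<^sub>R inf (- x) 0)"
    unfolding * using scaleR_inf[OF assms, of "- x" 0] by (simp del: neg_inf_eq_sup)
  also have "\<dots> = c *\<^sub>R pprt x" unfolding * by (simp del: neg_inf_eq_sup)
  finally show ?thesis .
qed

text \<open>Distributing the right-hand side gives the infimum of four sums; three of them dominate
  \<open>a\<close>, and the fourth is \<open>b + c\<close>.\<close>

lemma inf_add_le:
  fixes a b c :: "'a::banach_lattice"
  assumes "0 \<le> a" "0 \<le> b" "0 \<le> c"
  shows "inf a (b + c) \<le> inf a b + inf a c"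
proof -
  have "inf a b + inf a c = inf (inf (a + a) (b + a)) (inf (a + c) (b + c))"
    by (simp only: add_inf_distrib_left add_inf_distrib_right)
  moreover have "a \<le> a + a" "a \<le> b + a" "a \<le> a + c" using assms by auto
  ultimately show ?thesis by (simp add: le_infI1)
qed

lemma inf_sum_le:
  fixes a :: "'a::banach_lattice"
  assumes "0 \<le> a" "\<And>i. i \<in> I \<Longrightarrow> 0 \<le> f i"
  shows "inf a (sum f I) \<le> (\<Sum>i\<in>I. inf a (f i))"
  using assms(2)
proof (induction I rule: infinite_finite_induct)
  case (insert i I)
  have "inf a (sum f (insert i I)) \<le> inf a (f i) + inf a (sum f I)"
    using insert assms(1) by (simp add: inf_add_le sum_nonneg)
  also have "\<dots> \<le> inf a (f i) + (\<Sum>i\<in>I. inf a (f i))"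
    using insert by simp
  finally show ?case using insert by simp
qed auto

lemma inf_scaleR_le:
  fixes a b :: "'a::banach_lattice"
  assumes "0 \<le> a" "1 \<le> c"
  shows "inf a (c *\<^sub>R b) \<le> c *\<^sub>R inf a b"
proof -
  have "1 *\<^sub>R a \<le> c *\<^sub>R a" using assms by (intro scaleR_right_mono) auto
  then show ?thesis using assms by (simp add: scaleR_inf le_infI1)
qed

lemma inf_scaleR_eq_0:
  fixes a b :: "'a::banach_lattice"
  assumes "0 \<le> a" "0 \<le> b" "inf a b = 0" "0 \<le> c"
  shows "inf a (c *\<^sub>R b) = 0"
proof (rule antisym)
  have "inf a (c *\<^sub>R b) \<le> inf a (max 1 c *\<^sub>R b)"
    using assms by (intro inf_mono scaleR_right_mono) auto
  also have "\<dots> \<le> max 1 c *\<^sub>R inf a b" using assms by (intro inf_scaleR_le) auto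
  finally show "inf a (c *\<^sub>R b) \<le> 0" using assms by simp
qed (use assms in \<open>auto simp: scaleR_nonneg_nonneg\<close>)

lemma diff_inf_eq_pprt:
  fixes a b :: "'a::banach_lattice"
  shows "a - inf a b = pprt (a - b)"
  by (simp add: pprt_def add_sup_distrib_left sup_commute)

text \<open>Subtracting this infimum from \<open>pprt a\<close> leaves
  \<open>pprt (pprt a - pprt (- a))\<close>, which is \<open>pprt a\<close> again.\<close>

lemma inf_pprt_minus:
  fixes a :: "'a::banach_lattice"
  shows "inf (pprt a) (pprt (- a)) = 0"
proof -
  have "pprt a - inf (pprt a) (pprt (- a)) = pprt (pprt a - pprt (- a))"
    by (rule diff_inf_eq_pprt)
  also have "pprt a - pprt (- a) = a" using prts[of a] by (simp add: pprt_neg)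
  finally show ?thesis by (simp add: algebra_simps del: diff_inf_eq_sup)
qed

lemma inf_eq_0_mono:
  fixes a b c d :: "'a::banach_lattice"
  assumes "0 \<le> a" "0 \<le> b" "a \<le> c" "b \<le> d" "inf c d = 0"
  shows "inf a b = 0"
  using inf_mono[OF assms(3,4)] assms by (intro antisym) auto

lemma pprt_diff_le:
  fixes a b :: "'a::banach_lattice"
  assumes "0 \<le> a" "0 \<le> b"
  shows "pprt (a - b) \<le> a"
  using assms unfolding pprt_def by (intro sup_least) (auto simp: algebra_simps)

lemma le_pprt: "a \<le> pprt a" for a :: "'a::banach_lattice"
  by (simp add: pprt_def)

lemma pprt_add_le:
  fixes a b :: "'a::banach_lattice"
  assumes "0 \<le> b"
  shows "pprt (a + b) \<le> pprt a + b"
  unfolding pprt_def by (intro sup_least) (use assms in \<open>auto intro: add_nonneg_nonneg\<close>)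

text \<open>With \<open>i = inf a b\<close>, the elements \<open>pprt a\<close> and
  \<open>pprt b\<close> exceed \<open>pprt i\<close> by at most \<open>a - i\<close> and
  \<open>b - i\<close>, and these two excesses have infimum \<open>0\<close>.\<close>

lemma inf_pprt_le:
  fixes a b :: "'a::banach_lattice"
  shows "inf (pprt a) (pprt b) \<le> pprt (inf a b)"
proof -
  define i where "i = inf a b"
  have le: "pprt c \<le> pprt i + (c - i)" if "i \<le> c" for c
    using pprt_add_le[of "c - i" i] that by simp
  have "inf (pprt a) (pprt b) \<le> inf (pprt i + (a - i)) (pprt i + (b - i))"
    by (intro inf_mono le) (auto simp: i_def)
  also have "\<dots> = pprt i + (inf a b - i)"
    unfolding add_inf_distrib_left[symmetric] diff_conv_add_uminus add_inf_distrib_right ..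
  finally show ?thesis by (simp add: i_def)
qed

text \<open>The positive part of \<open>sum f {..<N} - suminf f\<close> is dominated by that of
  every later error \<open>sum f {..<n} - suminf f\<close>, whose norm tends to
  \<open>0\<close>.\<close>

lemma sum_nonneg_le_suminf:
  fixes f :: "nat \<Rightarrow> 'a::banach_lattice"
  assumes f: "summable f" "\<And>n. 0 \<le> f n"
  shows "sum f {..<N} \<le> suminf f"
proof -
  define z where "z = sum f {..<N} - suminf f"
  have "(\<lambda>n. norm (sum f {..<n} - suminf f)) \<longlonglongrightarrow> 0"
    using summable_LIMSEQ[OF f(1)] by (simp add: LIM_zero tendsto_norm_zero)
  moreover have "\<forall>\<^sub>F n in sequentially. norm (pprt z) \<le> norm (sum f {..<n} - suminf f)"
  proof (rule eventually_sequentiallyI)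
    fix n assume "N \<le> n"
    then have "z \<le> sum f {..<n} - suminf f"
      unfolding z_def using f(2) by (intro diff_right_mono sum_mono2) auto
    then have "pprt z \<le> pprt (sum f {..<n} - suminf f)" by (rule pprt_mono)
    then have "norm (pprt z) \<le> norm (pprt (sum f {..<n} - suminf f))"
      by (intro norm_mono_nonneg) auto
    then show "norm (pprt z) \<le> norm (sum f {..<n} - suminf f)"
      using norm_pprt_le order_trans by blast
  qed
  ultimately have "norm (pprt z) \<le> 0"
    using tendsto_lowerbound by (metis sequentially_bot trivial_limit_sequentially)
  then have "pprt z = 0" by simp
  then have "z \<le> 0" using le_pprt[of z] by simp
  then show ?thesis by (simp add: z_def)
qed

section \<open>Disjoint sequences\<close>

lemma disjoint_seq_nonneg:
  assumes "\<And>n. 0 \<le> x n"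
  shows "disjoint_seq x \<longleftrightarrow> (\<forall>m n. m < n \<longrightarrow> inf (x m) (x n) = 0)"
  unfolding disjoint_seq_def using assms
  by (auto simp: abs_of_nonneg) (metis inf_commute nat_neq_iff)

lemma disjoint_seq_subseq:
  assumes "disjoint_seq x" "strict_mono r"
  shows "disjoint_seq (\<lambda>n. x (r n))"
  using assms unfolding disjoint_seq_def by (metis strict_mono_eq)

lemma disjoint_seq_mono:
  assumes "disjoint_seq y" "\<And>n. \<bar>x n\<bar> \<le> \<bar>y n\<bar>"
  shows "disjoint_seq x"
  unfolding disjoint_seq_def
proof (intro allI impI)
  fix m n :: nat assume "m \<noteq> n"
  then have "inf \<bar>y m\<bar> \<bar>y n\<bar> = 0" using assms(1) by (simp add: disjoint_seq_def)
  then show "inf \<bar>x m\<bar> \<bar>x n\<bar> = 0"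
    by (rule inf_eq_0_mono[OF abs_ge_zero abs_ge_zero assms(2) assms(2)])
qed

text \<open>Finite sums of disjoint positive elements are suprema, because
  \<open>a + b = inf a b + sup a b\<close>.\<close>

lemma disjoint_seq_sum_le:
  fixes d :: "nat \<Rightarrow> 'a::banach_lattice"
  assumes "disjoint_seq d" "\<And>n. 0 \<le> d n" "\<And>n. d n \<le> u"
  shows "sum d {..<N} \<le> u"
proof (induction N)
  case 0
  then show ?case using order_trans[OF assms(2,3)] by simp
next
  case (Suc N)
  have "inf (d N) (sum d {..<N}) \<le> (\<Sum>i<N. inf (d N) (d i))"
    using assms by (intro inf_sum_le) auto
  also have "\<dots> = 0"
    using assms(1) unfolding disjoint_seq_nonneg[of d, OF assms(2)]
    by (intro sum.neutral) (auto simp: inf_commute)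
  finally have "inf (d N) (sum d {..<N}) = 0"
    using assms(2) by (intro antisym) (auto intro: sum_nonneg)
  then have "sum d {..<Suc N} = sup (d N) (sum d {..<N})"
    using add_eq_inf_sup[of "d N" "sum d {..<N}"] by (simp add: add.commute)
  also have "\<dots> \<le> u" using Suc assms by simp
  finally show ?case .
qed

text \<open>The weights are chosen so that \<open>v n \<le> pprt (x n - c x m)\<close> and
  \<open>v m \<le> pprt (x m - x n / c)\<close> with \<open>c = 2^(m + n) \<le> 4^n\<close> for \<open>m < n\<close>.\<close>

lemma disjointification:
  fixes x :: "nat \<Rightarrow> 'a::banach_lattice"
  assumes x: "\<And>n. 0 \<le> x n" and bdd: "\<And>n. norm (x n) \<le> C"
  obtains v w where "disjoint_seq v" "\<And>n. 0 \<le> v n" "\<And>n. v n \<le> x n" "0 \<le> w"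
    "\<And>n. pprt (x n - 4 ^ n *\<^sub>R (\<Sum>k<n. x k)) \<le> v n + (1/2) ^ n *\<^sub>R w"
proof -
  define f where "f = (\<lambda>k. (1/2) ^ k *\<^sub>R x k)"
  have f0: "0 \<le> f k" for k using x by (simp add: f_def scaleR_nonneg_nonneg)
  have "summable f"
  proof (rule summable_comparison_test')
    show "summable (\<lambda>k. (1/2::real) ^ k * C)" by (intro summable_mult2 summable_geometric) simp
    show "norm (f n) \<le> (1/2) ^ n * C" for n
      using bdd[of n] by (simp add: f_def field_simps)
  qed
  define w where "w = suminf f"
  have fw: "f k \<le> w" for k
  proof -
    have "f k \<le> sum f {..<Suc k}" using f0 by (simp add: sum_nonneg)
    also have "\<dots> \<le> w" unfolding w_def by (rule sum_nonneg_le_suminf[OF \<open>summable f\<close> f0])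
    finally show ?thesis .
  qed
  have w0: "0 \<le> w" using order_trans[OF f0 fw] .
  define s where "s = (\<lambda>n. 4 ^ n *\<^sub>R (\<Sum>k<n. x k))"
  have s0: "0 \<le> s n" for n using x by (simp add: s_def scaleR_nonneg_nonneg sum_nonneg)
  \<comment> \<open>The term \<open>s n\<close> removes the overlap with earlier members of
    \<open>x\<close>, the term with \<open>w\<close> the overlap with later ones.\<close>
  define v where "v = (\<lambda>n. pprt (x n - s n - (1/2) ^ n *\<^sub>R w))"
  have w0': "0 \<le> (1/2) ^ n *\<^sub>R w" for n :: nat using w0 by (simp add: scaleR_nonneg_nonneg)
  show ?thesis
  proof (rule that[of v w])
    show "0 \<le> v n" for n by (simp add: v_def)
    show "v n \<le> x n" for n
      unfolding v_def diff_diff_eq using x s0 w0' by (intro pprt_diff_le add_nonneg_nonneg) auto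
    show "0 \<le> w" by fact
    show "pprt (x n - 4 ^ n *\<^sub>R (\<Sum>k<n. x k)) \<le> v n + (1/2) ^ n *\<^sub>R w" for n
      using pprt_add_le[OF w0'[of n], of "x n - s n - (1/2) ^ n *\<^sub>R w"] by (simp add: v_def s_def)
    have "inf (v m) (v n) = 0" if mn: "m < n" for m n
    proof -
      define c :: real where "c = 2 ^ (m + n)"
      have c: "1 \<le> c" unfolding c_def by simp
      have "c \<le> 2 ^ (n + n)" unfolding c_def using mn by (intro power_increasing) auto
      also have "\<dots> = 4 ^ n" by (simp add: power_add flip: power_mult_distrib)
      finally have c4: "c \<le> 4 ^ n" .
      have "c *\<^sub>R x m \<le> 4 ^ n *\<^sub>R x m" using c4 x by (intro scaleR_right_mono)
      also have "\<dots> \<le> s n" unfolding s_def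
        using mn x sum_mono2[of "{..<n}" "{m}" x] by (intro scaleR_left_mono) auto
      also have "\<dots> \<le> s n + (1/2) ^ n *\<^sub>R w" using w0' by simp
      finally have n: "v n \<le> pprt (x n - c *\<^sub>R x m)"
        unfolding v_def diff_diff_eq by (intro pprt_mono diff_left_mono)
      have "inverse c *\<^sub>R x n = (1/2) ^ m *\<^sub>R f n"
        by (simp add: f_def c_def power_add power_divide divide_simps)
      also have "\<dots> \<le> (1/2) ^ m *\<^sub>R w" using fw by (intro scaleR_left_mono) auto
      also have "\<dots> \<le> s m + (1/2) ^ m *\<^sub>R w" using s0 by simp
      finally have "v m \<le> pprt (x m - inverse c *\<^sub>R x n)"
        unfolding v_def diff_diff_eq by (intro pprt_mono diff_left_mono)
      also have "x m - inverse c *\<^sub>R x n = inverse c *\<^sub>R (c *\<^sub>R x m - x n)"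
        using c by (simp add: algebra_simps)
      also have "pprt \<dots> = inverse c *\<^sub>R pprt (c *\<^sub>R x m - x n)"
        using c by (intro scaleR_pprt) simp
      also have "\<dots> \<le> 1 *\<^sub>R pprt (c *\<^sub>R x m - x n)"
        using c by (intro scaleR_right_mono) (auto simp: field_simps)
      finally have m: "v m \<le> pprt (- (x n - c *\<^sub>R x m))" by simp
      show ?thesis
      proof (rule inf_eq_0_mono[OF _ _ m n])
        show "inf (pprt (- (x n - c *\<^sub>R x m))) (pprt (x n - c *\<^sub>R x m)) = 0"
          using inf_pprt_minus[of "x n - c *\<^sub>R x m"] by (simp only: inf_commute)
      qed (simp_all add: v_def)
    qed
    then show "disjoint_seq v" by (subst disjoint_seq_nonneg) (auto simp: v_def)
  qed
qed

section \<open>Positive functionals and their infima\<close>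

lemma blinfun_nonneg: "0 \<le> f \<Longrightarrow> 0 \<le> x \<Longrightarrow> 0 \<le> blinfun_apply f x"
  for f :: "'a::banach_lattice \<Rightarrow>\<^sub>L real"
  by (simp add: less_eq_blinfun_def)

lemma blinfun_mono: "0 \<le> f \<Longrightarrow> x \<le> y \<Longrightarrow> blinfun_apply f x \<le> blinfun_apply f y"
  for f :: "'a::banach_lattice \<Rightarrow>\<^sub>L real"
  using blinfun_nonneg[of f "y - x"] by (simp add: blinfun.diff_right)

lemma blinfun_apply_mono: "f \<le> g \<Longrightarrow> 0 \<le> x \<Longrightarrow> blinfun_apply f x \<le> blinfun_apply g x"
  for f g :: "'a::banach_lattice \<Rightarrow>\<^sub>L real"
  by (simp add: less_eq_blinfun_def)

text \<open>By the Riesz-Kantorovich formula, \<open>inf f g\<close> at \<open>x\<close> is the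
  infimum of \<open>f (x - z) + g z\<close> over \<open>0 \<le> z \<le> x\<close>; \<open>z\<close>
  is a near-minimizer, found through the formula for \<open>sup (f - g) 0\<close>.\<close>

lemma blinfun_inf_split:
  fixes f g :: "'a::banach_lattice \<Rightarrow>\<^sub>L real"
  assumes "0 \<le> x" "0 < \<eta>"
  obtains z where "0 \<le> z" "z \<le> x"
    "blinfun_apply f (x - z) + blinfun_apply g z < blinfun_apply (inf f g) x + \<eta>"
proof -
  let ?S = "blinfun_apply (f - g) ` {0..x}"
  have "f - inf f g = sup (f - g) 0"
    using diff_inf_eq_pprt[of f g] unfolding pprt_def .
  then have "blinfun_apply f x - blinfun_apply (inf f g) x = blinfun_apply (sup (f - g) 0) x"
    by (metis blinfun.diff_left)
  also have "\<dots> = Sup ?S" by (rule blinfun_sup_0(1)[OF assms(1)])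
  finally have S: "Sup ?S = blinfun_apply f x - blinfun_apply (inf f g) x" by simp
  have "?S \<noteq> {}" using assms by auto
  moreover have "Sup ?S - \<eta> < Sup ?S" using assms by simp
  ultimately obtain z where "z \<in> {0..x}" "Sup ?S - \<eta> < blinfun_apply (f - g) z"
    using less_cSupE by (metis (no_types, lifting) imageE)
  then show ?thesis using S that[of z] by (simp add: blinfun.diff_left blinfun.diff_right)
qed

section \<open>Sequences\<close>

text \<open>Each index is chosen past the previous one and so large that \<open>Q\<close> holds
  against all indices up to the previous one at once. The first argument of \<open>Q\<close> is the
  position in the subsequence, so tolerances can be prescribed before the subsequence is
  known.\<close>

lemma sparse_subsequence:
  fixes Q :: "nat \<Rightarrow> nat \<Rightarrow> nat \<Rightarrow> bool"
  assumes Q: "\<And>m i. \<forall>\<^sub>F j in sequentially. Q m i j"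
  obtains r where "strict_mono r" "\<And>i m. i < m \<Longrightarrow> Q m (r i) (r m)"
proof -
  have "\<exists>r. \<forall>n. True \<and> (r n < r (Suc n) \<and> (\<forall>i\<le>r n. Q (Suc n) i (r (Suc n))))"
  proof (rule dependent_nat_choice)
    fix x n :: nat
    have "\<forall>\<^sub>F j in sequentially. x < j \<and> (\<forall>i\<in>{..x}. Q (Suc n) i j)"
      by (intro eventually_conj eventually_gt_at_top eventually_ball_finite) (auto intro: Q)
    then show "\<exists>y. True \<and> (x < y \<and> (\<forall>i\<le>x. Q (Suc n) i y))"
      using eventually_happens by fastforce
  qed auto
  then obtain r where r: "\<And>n. r n < r (Suc n)" "\<And>n i. i \<le> r n \<Longrightarrow> Q (Suc n) i (r (Suc n))"
    by blast
  have "strict_mono r" using r(1) by (simp add: strict_mono_Suc_iff)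
  moreover have "Q m (r i) (r m)" if "i < m" for i m
  proof -
    define n where "n = m - 1"
    then have n: "m = Suc n" "i \<le> n" using that by auto
    have "r i \<le> r n" using strict_mono_less_eq[OF \<open>strict_mono r\<close>] n(2) by simp
    from r(2)[OF this] show ?thesis using n(1) by simp
  qed
  ultimately show ?thesis by (rule that)
qed

lemma not_tendsto_0_subseq:
  fixes a :: "nat \<Rightarrow> real"
  assumes "\<not> a \<longlonglongrightarrow> 0" "\<And>n. 0 \<le> a n"
  obtains c r where "0 < c" "strict_mono r" "\<And>n::nat. c \<le> a (r n)"
proof -
  obtain c where c: "0 < c" "\<And>N. \<exists>n\<ge>N. \<not> norm (a n - 0) < c"
    using assms(1) unfolding LIMSEQ_iff by blast
  then have "\<exists>\<^sub>\<infinity>n. c \<le> a n"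
    unfolding INFM_nat_le using assms(2) by (simp add: not_less)
  then have "infinite {n. c \<le> a n}" by (simp add: frequently_cofinite)
  then obtain r :: "nat \<Rightarrow> nat" where "strict_mono r" "\<And>n. r n \<in> {n. c \<le> a n}"
    using infinite_enumerate by blast
  then show ?thesis using that c(1) by simp
qed

lemma half_power_sum_le: "(\<Sum>k\<in>{n..n+m}. (1/2) ^ k) \<le> 2 * (1/2::real) ^ n"
proof -
  have "(\<Sum>k\<in>{n..n+m}. (1/2) ^ k) = 2 * (1/2::real) ^ n - (1/2) ^ (n + m)"
    by (induction m) auto
  then show ?thesis by simp
qed

section \<open>Monotone seminorms on the positive cone\<close>

text \<open>The intended \<open>\<rho>\<close> is the supremum of a bounded sequence of positive
  functionals, hence the restriction of the axioms to positive elements.\<close>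

locale cone_seminorm =
  fixes \<rho> :: "'a::banach_lattice \<Rightarrow> real"
  assumes mono: "0 \<le> x \<Longrightarrow> x \<le> y \<Longrightarrow> \<rho> x \<le> \<rho> y"
    and add_le: "0 \<le> x \<Longrightarrow> 0 \<le> y \<Longrightarrow> \<rho> (x + y) \<le> \<rho> x + \<rho> y"
    and scale: "0 \<le> c \<Longrightarrow> 0 \<le> x \<Longrightarrow> \<rho> (c *\<^sub>R x) = c * \<rho> x"
begin

lemma zero [simp]: "\<rho> 0 = 0"
  using scale[of 0 0] by simp

lemma nonneg: "0 \<le> x \<Longrightarrow> 0 \<le> \<rho> x"
  using mono[of 0 x] by simp

lemma sum_le: "(\<And>i. i \<in> I \<Longrightarrow> 0 \<le> f i) \<Longrightarrow> \<rho> (sum f I) \<le> (\<Sum>i\<in>I. \<rho> (f i))"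
proof (induction I rule: infinite_finite_induct)
  case (insert i I)
  then have "\<rho> (sum f (insert i I)) \<le> \<rho> (f i) + \<rho> (sum f I)"
    by (simp add: add_le sum_nonneg)
  then show ?case using insert by fastforce
qed auto

text \<open>The disjoint-sequence condition of L-weak compactness with \<open>\<rho>\<close> in
  place of the norm. Positive sequences in \<open>B\<close> itself suffice, since the sets
  considered contain, with a positive element, everything between \<open>0\<close> and it.\<close>

definition disjointly_null :: "'a set \<Rightarrow> bool"
  where "disjointly_null B \<longleftrightarrow>
    (\<forall>v. disjoint_seq v \<and> (\<forall>n. 0 \<le> v n \<and> v n \<in> B) \<longrightarrow> (\<lambda>n. \<rho> (v n)) \<longlonglongrightarrow> 0)"

lemma disjointly_null_mono: "disjointly_null B \<Longrightarrow> A \<subseteq> B \<Longrightarrow> disjointly_null A"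
  unfolding disjointly_null_def by blast

text \<open>This is the gliding hump. What remains of \<open>x n\<close> after a large multiple of
  the earlier terms is removed lies below a member of a disjoint sequence in \<open>B\<close> plus a
  multiple of \<open>w\<close> that shrinks geometrically.\<close>

lemma tendsto_0_of_disjointly_null:
  assumes B: "disjointly_null B" "\<And>y b. 0 \<le> y \<Longrightarrow> y \<le> b \<Longrightarrow> b \<in> B \<Longrightarrow> y \<in> B"
    and x: "\<And>n. 0 \<le> x n" "\<And>n. x n \<in> B" and bdd: "\<And>n. norm (x n) \<le> C"
  shows "(\<lambda>n. \<rho> (pprt (x n - 4 ^ n *\<^sub>R (\<Sum>k<n. x k)))) \<longlonglongrightarrow> 0"
proof -
  obtain v w where v: "disjoint_seq v" "\<And>n. 0 \<le> v n" "\<And>n. v n \<le> x n" and w: "0 \<le> w"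
    and le: "\<And>n. pprt (x n - 4 ^ n *\<^sub>R (\<Sum>k<n. x k)) \<le> v n + (1/2) ^ n *\<^sub>R w"
    using disjointification[of x C, OF x(1) bdd] by blast
  have "v n \<in> B" for n using B(2)[of "v n" "x n"] v x by simp
  then have "(\<lambda>n. \<rho> (v n)) \<longlonglongrightarrow> 0" using B(1) v(1,2) by (simp add: disjointly_null_def)
  moreover have "(\<lambda>n. (1/2) ^ n * \<rho> w) \<longlonglongrightarrow> 0"
    by (intro tendsto_mult_left_zero LIMSEQ_power_zero) simp
  ultimately have lim: "(\<lambda>n. \<rho> (v n) + (1/2) ^ n * \<rho> w) \<longlonglongrightarrow> 0"
    using tendsto_add_zero by blast
  have le': "\<rho> (pprt (x n - 4 ^ n *\<^sub>R (\<Sum>k<n. x k))) \<le> \<rho> (v n) + (1/2) ^ n * \<rho> w" for n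
  proof -
    have w': "0 \<le> (1/2) ^ n *\<^sub>R w" using w by (simp add: scaleR_nonneg_nonneg)
    have "\<rho> (pprt (x n - 4 ^ n *\<^sub>R (\<Sum>k<n. x k))) \<le> \<rho> (v n + (1/2) ^ n *\<^sub>R w)"
      by (intro mono le) simp
    also have "\<dots> \<le> \<rho> (v n) + \<rho> ((1/2) ^ n *\<^sub>R w)" using v(2) w' by (rule add_le)
    also have "\<dots> = \<rho> (v n) + (1/2) ^ n * \<rho> w" using w by (simp add: scale)
    finally show ?thesis .
  qed
  show ?thesis
    by (rule tendsto_sandwich[OF _ _ tendsto_const lim]) (auto intro!: always_eventually le' nonneg)
qed

text \<open>Let any \<open>K + 1\<close> members of \<open>e\<close> be jointly disjoint. For fixed \<open>n\<close> the sequence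
  \<open>inf (e n) (e m)\<close> has this property with \<open>K\<close> in place of \<open>K + 1\<close>, so a sparse
  subsequence of \<open>e\<close> is almost disjoint.\<close>

lemma tendsto_0_of_finite_multiplicity:
  assumes u: "disjointly_null {0..u}" and e: "\<And>n. 0 \<le> e n" "\<And>n. e n \<le> u"
    and K: "\<And>I z. finite I \<Longrightarrow> card I = Suc K \<Longrightarrow> 0 \<le> z \<Longrightarrow> (\<And>i. i \<in> I \<Longrightarrow> z \<le> e i) \<Longrightarrow> z = 0"
  shows "(\<lambda>n. \<rho> (e n)) \<longlonglongrightarrow> 0"
  using e K
proof (induction K arbitrary: e)
  case 0
  have "e n = 0" for n using "0.prems"(3)[of "{n}" "e n"] "0.prems"(1) by simp
  then show ?case by simp
next
  case (Suc K)
  have inf0: "(\<lambda>m. \<rho> (inf (e m) (e n))) \<longlonglongrightarrow> 0" for n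
  proof -
    \<comment> \<open>The shift by \<open>Suc n\<close> keeps the index \<open>n\<close> out of the
      sequence, so \<open>Suc K\<close> shifted indices together with \<open>n\<close> are
      \<open>Suc (Suc K)\<close> distinct ones.\<close>
    have "(\<lambda>m. \<rho> (inf (e (m + Suc n)) (e n))) \<longlonglongrightarrow> 0"
    proof (rule Suc.IH)
      fix m show "0 \<le> inf (e (m + Suc n)) (e n)" using Suc.prems(1) by simp
      show "inf (e (m + Suc n)) (e n) \<le> u" using Suc.prems(2) le_infI2 by blast
    next
      fix I z
      assume I: "finite I" "card I = Suc K" "(0::'a) \<le> z"
        "\<And>i. i \<in> I \<Longrightarrow> z \<le> inf (e (i + Suc n)) (e n)"
      define J where "J = insert n ((\<lambda>i. i + Suc n) ` I)"
      have "card J = Suc (Suc K)"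
        unfolding J_def using I(1,2) by (subst card_insert_disjoint) (auto simp: card_image inj_on_def)
      moreover have "I \<noteq> {}" using I by auto
      then obtain i0 where "i0 \<in> I" by blast
      then have "z \<le> e n" using I(4) by auto
      then have "z \<le> e i" if "i \<in> J" for i using that I(4) unfolding J_def by auto
      ultimately show "z = 0" using Suc.prems(3)[of J z] I(1,3) by (simp add: J_def)
    qed
    then show ?thesis by (rule LIMSEQ_offset)
  qed
  show ?case
  proof (rule ccontr)
    assume "\<not> ?thesis"
    then obtain c r where c: "0 < c" and r: "strict_mono r" "\<And>n::nat. c \<le> \<rho> (e (r n))"
      using not_tendsto_0_subseq[of "\<lambda>n. \<rho> (e n)"] nonneg[OF Suc.prems(1)] by blast
    \<comment> \<open>The overlap of \<open>x n\<close> with \<open>4 ^ n\<close> times the sum of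
      its \<open>n\<close> predecessors then costs at most \<open>4 ^ n * n * d n\<close>, which is
      below \<open>1 / (n + 1)\<close>.\<close>
    define d where "d = (\<lambda>m::nat. 1 / (4 ^ m * (real m + 1) ^ 2))"
    have d0: "0 < d m" for m by (simp add: d_def)
    have "\<forall>\<^sub>F j in sequentially. \<rho> (inf (e (r j)) (e (r i))) < d m" for m i
      using order_tendstoD(2)[OF LIMSEQ_subseq_LIMSEQ[OF inf0 r(1)] d0[of m]] by (simp add: o_def)
    then obtain q where q: "strict_mono q"
      "\<And>i m. i < m \<Longrightarrow> \<rho> (inf (e (r (q m))) (e (r (q i)))) < d m"

      using sparse_subsequence[of "\<lambda>m i j. \<rho> (inf (e (r j)) (e (r i))) < d m"] by blast
    define x where "x = (\<lambda>n. e (r (q n)))"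
    have x: "0 \<le> x n" "x n \<le> u" for n using Suc.prems by (simp_all add: x_def)
    have "(\<lambda>n. \<rho> (pprt (x n - 4 ^ n *\<^sub>R (\<Sum>k<n. x k)))) \<longlonglongrightarrow> 0"
      by (rule tendsto_0_of_disjointly_null[OF u, where C = "norm u"])
        (use x in \<open>auto intro: norm_mono_nonneg\<close>)
    moreover have "(\<lambda>n. 1 / (real n + 1)) \<longlonglongrightarrow> 0"
      using LIMSEQ_inverse_real_of_nat by (simp add: inverse_eq_divide add.commute)
    ultimately have lim: "(\<lambda>n. \<rho> (pprt (x n - 4 ^ n *\<^sub>R (\<Sum>k<n. x k))) + 1 / (real n + 1)) \<longlonglongrightarrow> 0"
      using tendsto_add_zero by blast
    have "c \<le> \<rho> (pprt (x n - 4 ^ n *\<^sub>R (\<Sum>k<n. x k))) + 1 / (real n + 1)" for n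
    proof -
      let ?s = "\<Sum>k<n. x k"
      have s0: "0 \<le> ?s" using x by (simp add: sum_nonneg)
      have "inf (x n) (4 ^ n *\<^sub>R ?s) \<le> 4 ^ n *\<^sub>R inf (x n) ?s"
        using x by (intro inf_scaleR_le) auto
      also have "\<dots> \<le> 4 ^ n *\<^sub>R (\<Sum>k<n. inf (x n) (x k))"
        using x by (intro scaleR_left_mono inf_sum_le) auto
      finally have le: "inf (x n) (4 ^ n *\<^sub>R ?s) \<le> 4 ^ n *\<^sub>R (\<Sum>k<n. inf (x n) (x k))" .
      have i0: "0 \<le> inf (x n) (x k)" for k using x by simp
      have "\<rho> (4 ^ n *\<^sub>R (\<Sum>k<n. inf (x n) (x k))) = 4 ^ n * \<rho> (\<Sum>k<n. inf (x n) (x k))"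
        using i0 by (intro scale sum_nonneg) auto
      also have "\<dots> \<le> 4 ^ n * (\<Sum>k<n. \<rho> (inf (x n) (x k)))"
        using i0 by (intro mult_left_mono sum_le) auto
      also have "\<dots> \<le> 4 ^ n * (\<Sum>k<n. d n)"
        using q(2) by (intro mult_left_mono sum_mono) (auto simp: x_def less_imp_le)
      also have "\<dots> = real n / (real n + 1) ^ 2" by (simp add: d_def)
      also have "\<dots> \<le> 1 / (real n + 1)" by (simp add: divide_simps power2_eq_square)
      finally have b: "\<rho> (4 ^ n *\<^sub>R (\<Sum>k<n. inf (x n) (x k))) \<le> 1 / (real n + 1)" .
      \<comment> \<open>The first part tends to \<open>0\<close> by the gliding hump, the second by
        the choice of \<open>d\<close>, while \<open>\<rho> (x n)\<close> stays above
        \<open>c\<close>.\<close>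
      have "x n = pprt (x n - 4 ^ n *\<^sub>R ?s) + inf (x n) (4 ^ n *\<^sub>R ?s)"
        using diff_inf_eq_pprt[of "x n" "4 ^ n *\<^sub>R ?s"] by (simp add: algebra_simps del: diff_inf_eq_sup)
      also have "\<rho> \<dots> \<le> \<rho> (pprt (x n - 4 ^ n *\<^sub>R ?s)) + \<rho> (inf (x n) (4 ^ n *\<^sub>R ?s))"
        using x s0 by (intro add_le) (auto simp: scaleR_nonneg_nonneg)
      also have "\<rho> (inf (x n) (4 ^ n *\<^sub>R ?s)) \<le> \<rho> (4 ^ n *\<^sub>R (\<Sum>k<n. inf (x n) (x k)))"
        using x s0 by (intro mono le) (auto simp: scaleR_nonneg_nonneg)
      finally show ?thesis using r(2)[of "q n"] b by (simp add: x_def)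
    qed
    then have "c \<le> 0" using tendsto_lowerbound[OF lim] by auto
    then show False using c by simp
  qed
qed

text \<open>Otherwise there are increments \<open>d k\<close> with
  \<open>\<rho> (d k) > \<epsilon>\<close> whose finite sums stay below \<open>u\<close>. After
  \<open>u / K\<close> is cut off from each, no \<open>K\<close> of the remainders have a common
  positive minorant other than \<open>0\<close>, so the remainders tend to \<open>0\<close> in
  \<open>\<rho>\<close>; the part cut off is small for large \<open>K\<close>.\<close>

lemma Cauchy_of_mono:
  assumes u: "disjointly_null {0..u}"
    and x: "\<And>n. x n \<le> x (Suc n)" "\<And>n. 0 \<le> x n" "\<And>n. x n \<le> u" and \<epsilon>: "0 < \<epsilon>"
  shows "\<exists>N. \<forall>n\<ge>N. \<rho> (x n - x N) \<le> \<epsilon>"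
proof (rule ccontr)
  assume "\<not> ?thesis"
  then have "\<forall>N. \<exists>n\<ge>N. \<epsilon> < \<rho> (x n - x N)" by (simp add: not_le)
  then obtain g where g: "\<And>N. N \<le> g N" "\<And>N. \<epsilon> < \<rho> (x (g N) - x N)" by metis
  define r where "r = (\<lambda>k. (g ^^ k) 0)"
  define d where "d = (\<lambda>k. x (r (Suc k)) - x (r k))"
  have xmono: "x m \<le> x n" if "m \<le> n" for m n
    using lift_Suc_mono_le[of x m n] x(1) that by simp
  have d0: "0 \<le> d k" for k using xmono g(1) by (simp add: d_def r_def)
  have d\<epsilon>: "\<epsilon> < \<rho> (d k)" for k using g(2) by (simp add: d_def r_def)
  have dsum: "sum d {..<n} \<le> u" for n
  proof -
    have "sum d {..<n} = x (r n) - x (r 0)" unfolding d_def by (rule sum_lessThan_telescope)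
    also have "\<dots> \<le> x (r n)" using x(2) by simp
    finally show ?thesis using x(3) order_trans by blast
  qed
  have dI: "sum d I \<le> u" if "finite I" for I
  proof -
    obtain n where "I \<subseteq> {..<n}" using finite_nat_bounded \<open>finite I\<close> by blast
    then have "sum d I \<le> sum d {..<n}" using d0 by (intro sum_mono2) auto
    then show ?thesis using dsum order_trans by blast
  qed
  have u0: "0 \<le> u" using order_trans[OF x(2,3)] .
  \<comment> \<open>This makes the loss \<open>\<rho> u / K\<close> from cutting off
    \<open>u / K\<close> less than \<open>\<epsilon> / 2\<close>.\<close>
  obtain K :: nat where K: "\<rho> u / (\<epsilon> / 2) < real K" using reals_Archimedean2 by blast
  have "0 \<le> \<rho> u / (\<epsilon> / 2)" using nonneg[OF u0] \<epsilon> by simp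
  then have K0: "0 < real K" using K by linarith
  then obtain K' where K': "K = Suc K'" by (cases K) auto
  define e where "e = (\<lambda>k. pprt (d k - (1 / K) *\<^sub>R u))"
  have uK: "0 \<le> (1 / K) *\<^sub>R u" using u0 by (simp add: scaleR_nonneg_nonneg)
  have "(\<lambda>k. \<rho> (e k)) \<longlonglongrightarrow> 0"
  proof (rule tendsto_0_of_finite_multiplicity[OF u])
    show "0 \<le> e n" for n by (simp add: e_def)
    show "e n \<le> u" for n
    proof -
      have "e n \<le> d n" unfolding e_def using d0 uK by (rule pprt_diff_le)
      also have "d n \<le> u" using dI[of "{n}"] by simp
      finally show ?thesis .
    qed
    fix I and z :: 'a
    assume I: "finite I" "card I = Suc K'" and z: "0 \<le> z" "\<And>i. i \<in> I \<Longrightarrow> z \<le> e i"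
    \<comment> \<open>A minorant of the positive parts is traded for an element \<open>w\<close>
      below all \<open>d i - u / K\<close> themselves, which can be summed. The empty set is served
      by \<open>w = z\<close>.\<close>
    have fin: "\<exists>w. (\<forall>i\<in>J. w \<le> d i - (1 / K) *\<^sub>R u) \<and> z \<le> pprt w" if "finite J" "J \<subseteq> I" for J
      using that
    proof (induction J rule: finite_induct)
      case empty
      show ?case using z(1) by (intro exI[of _ z]) simp
    next
      case (insert j J)
      then obtain w where w: "\<forall>i\<in>J. w \<le> d i - (1 / K) *\<^sub>R u" "z \<le> pprt w" by auto
      have "z \<le> inf (pprt w) (e j)" using w(2) z(2) insert.prems by simp
      also have "\<dots> \<le> pprt (inf w (d j - (1 / K) *\<^sub>R u))"
        unfolding e_def by (rule inf_pprt_le)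
      finally have "z \<le> pprt (inf w (d j - (1 / K) *\<^sub>R u))" .
      moreover have "\<forall>i\<in>insert j J. inf w (d j - (1 / K) *\<^sub>R u) \<le> d i - (1 / K) *\<^sub>R u"
        using w(1) by (auto intro: le_infI1)
      ultimately show ?case by blast
    qed
    obtain w where w: "\<And>i. i \<in> I \<Longrightarrow> w \<le> d i - (1 / K) *\<^sub>R u" "z \<le> pprt w"
      using fin[OF I(1) subset_refl] by auto
    \<comment> \<open>As \<open>card I = K\<close>, the subtracted terms add up to exactly one copy
      of \<open>u\<close>, which dominates the sum of the \<open>d i\<close>.\<close>
    have "real K *\<^sub>R w = (\<Sum>i\<in>I. w)" using I K' by (simp add: sum_constant_scaleR)
    also have "\<dots> \<le> (\<Sum>i\<in>I. d i - (1 / K) *\<^sub>R u)" by (rule sum_mono[OF w(1)])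
    also have "\<dots> = sum d I - u" using I K' K0 by (simp add: sum_subtractf sum_constant_scaleR)
    also have "\<dots> \<le> 0" using dI[OF I(1)] by simp
    finally have "(1 / K) *\<^sub>R (real K *\<^sub>R w) \<le> (1 / K) *\<^sub>R 0"
      by (intro scaleR_left_mono) auto
    then have "w \<le> 0" using K0 by simp
    then show "z = 0" using w(2) z(1) by simp
  qed
  then have "\<forall>\<^sub>F k in sequentially. \<rho> (e k) < \<epsilon> / 2" using \<epsilon> by (intro order_tendstoD(2)) auto
  then obtain k where k: "\<rho> (e k) < \<epsilon> / 2" using eventually_happens by force
  have "d k \<le> e k + (1 / K) *\<^sub>R u"
    using le_pprt[of "d k - (1 / K) *\<^sub>R u"] by (simp add: e_def algebra_simps)
  then have "\<rho> (d k) \<le> \<rho> (e k + (1 / K) *\<^sub>R u)" using d0 by (intro mono)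
  also have "\<dots> \<le> \<rho> (e k) + \<rho> ((1 / K) *\<^sub>R u)" using uK by (intro add_le) (auto simp: e_def)
  also have "\<rho> ((1 / K) *\<^sub>R u) = \<rho> u / K" using u0 by (simp add: scale)
  also have "\<rho> u / K < \<epsilon> / 2" using K K0 \<epsilon> by (simp add: field_simps)
  finally show False using k d\<epsilon>[of k] by simp
qed


section \<open>Asymptotically disjoint functionals\<close>

text \<open>If the values stay above \<open>c\<close> along a subsequence \<open>h\<close>, there
  are pieces \<open>z m\<close> of \<open>u\<close> on which \<open>h m\<close> is almost as large
  and all earlier \<open>h j\<close> are small. The \<open>t n\<close> approximate suprema of the
  tails of \<open>z\<close>, and \<open>t'\<close> consists of their running infima. Then
  \<open>h p\<close> is large on \<open>t' p\<close> and small on \<open>t' (Suc p)\<close>,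
  although \<open>t'\<close> is \<open>\<rho>\<close>-Cauchy.\<close>

lemma functional_tendsto_0:
  fixes f :: "nat \<Rightarrow> 'a \<Rightarrow>\<^sub>L real"
  assumes u: "disjointly_null {0..u}" "0 \<le> u"
    and f: "\<And>n. 0 \<le> f n" "\<And>n x. 0 \<le> x \<Longrightarrow> blinfun_apply (f n) x \<le> \<rho> x"
    and inf: "\<And>j. (\<lambda>n. blinfun_apply (inf (f n) (f j)) u) \<longlonglongrightarrow> 0"
  shows "(\<lambda>n. blinfun_apply (f n) u) \<longlonglongrightarrow> 0"
proof (rule ccontr)
  assume "\<not> ?thesis"
  then obtain c r where c: "0 < c" and r: "strict_mono r" "\<And>n::nat. c \<le> blinfun_apply (f (r n)) u"
    using not_tendsto_0_subseq[of "\<lambda>n. blinfun_apply (f n) u"] blinfun_nonneg[OF f(1) u(2)] by blast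
  \<comment> \<open>The overlaps of \<open>h m\<close> with its \<open>m\<close> predecessors add up
    to at most \<open>m * \<eta> m \<le> (1/2) ^ m\<close>.\<close>
  define \<eta> where "\<eta> = (\<lambda>m::nat. (1/2) ^ m / (real m + 1))"
  have \<eta>0: "0 < \<eta> m" for m by (simp add: \<eta>_def)
  define Q where "Q = (\<lambda>m i j. blinfun_apply (inf (f (r j)) (f (r i))) u < \<eta> m)"
  have "\<forall>\<^sub>F j in sequentially. Q m i j" for m i
    using order_tendstoD(2)[OF LIMSEQ_subseq_LIMSEQ[OF inf r(1)] \<eta>0] by (simp add: o_def Q_def)
  then obtain q where q: "\<And>i m. i < m \<Longrightarrow> Q m (q i) (q m)"
    using sparse_subsequence[of Q] by blast
  define h where "h = (\<lambda>n. f (r (q n)))"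
  have h: "0 \<le> h n" "c \<le> blinfun_apply (h n) u" for n using f r by (simp_all add: h_def)
  have h\<rho>: "blinfun_apply (h n) x \<le> \<rho> x" if "0 \<le> x" for n x using f(2) that by (simp add: h_def)
  \<comment> \<open>The element \<open>u\<close> is split for the infimum of \<open>h m\<close> and
    the sum of its predecessors: \<open>h m\<close> is small on \<open>u - z\<close>, and each
    predecessor is small on \<open>z\<close>.\<close>
  have "\<exists>z. 0 \<le> z \<and> z \<le> u \<and> c - 2 * (1/2) ^ m \<le> blinfun_apply (h m) z \<and>
      (\<forall>j<m. blinfun_apply (h j) z \<le> 2 * (1/2) ^ m)" for m
  proof -
    obtain z where z: "0 \<le> z" "z \<le> u" "blinfun_apply (h m) (u - z) + blinfun_apply (\<Sum>j<m. h j) z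
        < blinfun_apply (inf (h m) (\<Sum>j<m. h j)) u + (1/2) ^ m"
      using blinfun_inf_split[OF u(2), of "(1/2) ^ m"] by auto
    have "blinfun_apply (inf (h m) (\<Sum>j<m. h j)) u \<le> blinfun_apply (\<Sum>j<m. inf (h m) (h j)) u"
      using h by (intro blinfun_apply_mono inf_sum_le u) auto
    also have "\<dots> = (\<Sum>j<m. blinfun_apply (inf (h m) (h j)) u)" by (rule blinfun.sum_left)
    also have "\<dots> \<le> (\<Sum>j<m. \<eta> m)"
      using q by (intro sum_mono) (auto simp: Q_def h_def less_imp_le)
    also have "\<dots> \<le> (1/2) ^ m" by (simp add: \<eta>_def divide_simps)
    finally have lt: "blinfun_apply (h m) (u - z) + blinfun_apply (\<Sum>j<m. h j) z < 2 * (1/2) ^ m"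
      using z(3) by simp
    have "0 \<le> blinfun_apply (h m) (u - z)" using h z by (intro blinfun_nonneg) auto
    moreover have "blinfun_apply (h j) z \<le> blinfun_apply (\<Sum>j<m. h j) z" if "j < m" for j
      using that h sum_mono2[of "{..<m}" "{j}" h] by (intro blinfun_apply_mono z) auto
    moreover have "0 \<le> blinfun_apply (\<Sum>j<m. h j) z"
      using h by (intro blinfun_nonneg z sum_nonneg) auto
    ultimately have "c - 2 * (1/2) ^ m \<le> blinfun_apply (h m) z \<and>
        (\<forall>j<m. blinfun_apply (h j) z \<le> 2 * (1/2) ^ m)"
      using lt h(2)[of m] by (force simp: blinfun.diff_right)
    then show ?thesis using z by blast
  qed
  then obtain z where z: "\<And>m. 0 \<le> z m" "\<And>m. z m \<le> u"
    "\<And>m. c - 2 * (1/2) ^ m \<le> blinfun_apply (h m) (z m)"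
    "\<And>m j. j < m \<Longrightarrow> blinfun_apply (h j) (z m) \<le> 2 * (1/2) ^ m"
    by metis
  define s where "s = (\<lambda>n m. Sup_fin (z ` {n..n+m}))"
  have z_le_s: "z k \<le> s n m" if "n \<le> k" "k \<le> n + m" for n m k
    unfolding s_def using that by (intro Sup_fin.coboundedI) auto
  have s_le: "s n m \<le> y" if "\<And>k. n \<le> k \<Longrightarrow> k \<le> n + m \<Longrightarrow> z k \<le> y" for n m y
    unfolding s_def using that by (intro Sup_fin.boundedI) auto
  have s: "0 \<le> s n m" "s n m \<le> u" for n m
    using z(1)[of n] z_le_s[of n n m] s_le[of n m u] z(2) by (auto intro: order_trans)
  \<comment> \<open>The quantity \<open>\<delta>\<close> is lost three times, twice in
    \<open>t'_lower\<close> and once in the final Cauchy estimate, and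
    \<open>3 * \<delta> < c\<close>.\<close>
  define \<delta> where "\<delta> = c / 4"
  have \<delta>: "0 < \<delta>" using c by (simp add: \<delta>_def)
  \<comment> \<open>The supremum of a whole tail of \<open>z\<close> may not exist. Instead there is
    a finite stage after which further growth of \<open>s n\<close> is at most
    \<open>\<delta> * (1/2) ^ n\<close> in \<open>\<rho>\<close>.\<close>
  have "\<exists>\<mu>. \<forall>m\<ge>\<mu>. \<rho> (s n m - s n \<mu>) \<le> \<delta> * (1/2) ^ n" for n
  proof -
    have "s n m \<le> s n (Suc m)" for m by (intro s_le z_le_s) auto
    then show ?thesis using \<delta> s by (intro Cauchy_of_mono[OF u(1)]) auto
  qed
  then obtain \<mu> where \<mu>: "\<And>n m. \<mu> n \<le> m \<Longrightarrow> \<rho> (s n m - s n (\<mu> n)) \<le> \<delta> * (1/2) ^ n"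
    by metis
  define t where "t = (\<lambda>n. s n (\<mu> n))"
  \<comment> \<open>The \<open>t n\<close> need not decrease, because each stops at its own finite
    stage; the running infima do.\<close>
  define t' where "t' = (\<lambda>n. Inf_fin (t ` {..n}))"
  have t'_le: "t' n \<le> t i" if "i \<le> n" for n i
    unfolding t'_def using that by (intro Inf_fin.coboundedI) auto
  have le_t': "y \<le> t' n" if "\<And>i. i \<le> n \<Longrightarrow> y \<le> t i" for n y
    unfolding t'_def using that by (intro Inf_fin.boundedI) auto
  have t': "0 \<le> t' n" "t' n \<le> u" for n
    using le_t'[of n 0] t'_le[of n n] s by (auto simp: t_def intro: order_trans)
  have t'_anti: "t' n \<le> t' m" if "m \<le> n" for m n
    using that by (intro le_t' t'_le) auto
  have t'_lower: "c - 2 * (1/2) ^ n - 2 * \<delta> \<le> blinfun_apply (h n) (t' n)" for n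
  proof -
    \<comment> \<open>The stage \<open>n + \<mu> n + \<mu> i\<close> covers all indices used in
      \<open>t n\<close>, so for \<open>i \<le> n\<close> the longer supremum dominates
      \<open>t n\<close>; being past \<open>\<mu> i\<close>, it still exceeds \<open>t i\<close>
      only by a small amount.\<close>
    define e where "e = (\<lambda>i. s i (n + \<mu> n + \<mu> i) - t i)"
    have e0: "0 \<le> e i" for i unfolding e_def t_def
      by (simp, intro s_le z_le_s) auto
    have e\<rho>: "\<rho> (e i) \<le> \<delta> * (1/2) ^ i" for i unfolding e_def t_def by (rule \<mu>) simp
    have "t n - sum e {0..0+n} \<le> t' n"
    proof (rule le_t')
      fix i assume i: "i \<le> n"
      have "t n \<le> s i (n + \<mu> n + \<mu> i)" unfolding t_def using i by (intro s_le z_le_s) auto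
      also have "\<dots> = t i + e i" by (simp add: e_def)
      also have "e i \<le> sum e {0..0+n}" using sum_mono2[of "{0..0+n}" "{i}" e] i e0 by simp
      finally show "t n - sum e {0..0+n} \<le> t i" by (simp add: diff_le_eq)
    qed
    then have "blinfun_apply (h n) (t n - sum e {0..0+n}) \<le> blinfun_apply (h n) (t' n)"
      using h by (intro blinfun_mono)
    moreover have "blinfun_apply (h n) (sum e {0..0+n}) \<le> 2 * \<delta>"
    proof -
      have "blinfun_apply (h n) (sum e {0..0+n}) \<le> \<rho> (sum e {0..0+n})"
        using e0 by (intro h\<rho> sum_nonneg)
      also have "\<dots> \<le> (\<Sum>i\<in>{0..0+n}. \<rho> (e i))" using e0 by (intro sum_le)
      also have "\<dots> \<le> (\<Sum>i\<in>{0..0+n}. \<delta> * (1/2) ^ i)" by (intro sum_mono e\<rho>)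
      also have "\<dots> \<le> \<delta> * (2 * (1/2) ^ 0)"
        unfolding sum_distrib_left[symmetric] using \<delta> by (intro mult_left_mono half_power_sum_le) auto
      finally show ?thesis by simp
    qed
    moreover have "blinfun_apply (h n) (z n) \<le> blinfun_apply (h n) (t n)"
      unfolding t_def using h by (intro blinfun_mono z_le_s) auto
    ultimately show ?thesis using z(3)[of n] by (simp add: blinfun.diff_right)
  qed
  have t_upper: "blinfun_apply (h p) (t n) \<le> 4 * (1/2) ^ n" if "p < n" for p n
  proof -
    have "t n \<le> (\<Sum>k\<in>{n..n+\<mu> n}. z k)" unfolding t_def
    proof (rule s_le)
      fix k assume "n \<le> k" "k \<le> n + \<mu> n"
      then show "z k \<le> (\<Sum>k\<in>{n..n+\<mu> n}. z k)" using sum_mono2[of "{n..n+\<mu> n}" "{k}" z] z(1) by simp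
    qed
    then have "blinfun_apply (h p) (t n) \<le> blinfun_apply (h p) (\<Sum>k\<in>{n..n+\<mu> n}. z k)"
      using h by (intro blinfun_mono)
    also have "\<dots> = (\<Sum>k\<in>{n..n+\<mu> n}. blinfun_apply (h p) (z k))" by (rule blinfun.sum_right)
    also have "\<dots> \<le> (\<Sum>k\<in>{n..n+\<mu> n}. 2 * (1/2) ^ k)" using that by (intro sum_mono z(4)) auto
    also have "\<dots> \<le> 2 * (2 * (1/2) ^ n)"
      unfolding sum_distrib_left[symmetric] by (intro mult_left_mono half_power_sum_le) auto
    finally show ?thesis by simp
  qed
  \<comment> \<open>The sequence \<open>t'\<close> decreases, so its complements in \<open>u\<close>
    form the increasing sequence to which the Cauchy property applies.\<close>
  have "\<exists>N. \<forall>n\<ge>N. \<rho> ((u - t' n) - (u - t' N)) \<le> \<delta>"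
  proof (rule Cauchy_of_mono[OF u(1), of "\<lambda>n. u - t' n" \<delta>])
    show "u - t' n \<le> u - t' (Suc n)" for n using t'_anti[of n "Suc n"] by simp
    show "0 \<le> u - t' n" "u - t' n \<le> u" for n using t' by auto
    show "0 < \<delta>" by fact
  qed
  then obtain N where N: "\<And>n. N \<le> n \<Longrightarrow> \<rho> ((u - t' n) - (u - t' N)) \<le> \<delta>" by blast
  have upper: "c \<le> 4 * (1/2) ^ p + 3 * \<delta>" if p: "N \<le> p" for p
  proof -
    have "t' p - t' (Suc p) \<le> (u - t' (Suc p)) - (u - t' N)" using t'_anti[OF p] by simp
    then have "\<rho> (t' p - t' (Suc p)) \<le> \<delta>"
      using mono[of "t' p - t' (Suc p)"] N[of "Suc p"] p t'_anti[of p "Suc p"]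
      by (meson diff_ge_0_iff_ge le_SucI order_trans order_refl)
    then have "blinfun_apply (h p) (t' p - t' (Suc p)) \<le> \<delta>"
      using h\<rho>[of "t' p - t' (Suc p)" p] t'_anti[of p "Suc p"] by simp
    moreover have "blinfun_apply (h p) (t' (Suc p)) \<le> blinfun_apply (h p) (t (Suc p))"
      using h by (intro blinfun_mono t'_le) auto
    ultimately show ?thesis
      using t'_lower[of p] t_upper[of p "Suc p"] by (simp add: blinfun.diff_right)
  qed
  have lim: "(\<lambda>p. 4 * (1/2) ^ p + 3 * \<delta>) \<longlonglongrightarrow> 4 * 0 + 3 * \<delta>"
    by (intro tendsto_intros LIMSEQ_power_zero) simp
  have "c \<le> 4 * 0 + 3 * \<delta>"
    by (rule tendsto_lowerbound[OF lim]) (auto intro!: eventually_sequentiallyI[of N] upper)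
  then show False using c by (simp add: \<delta>_def)
qed

text \<open>If no finite family worked, each chosen family could be extended by an
  \<open>x n\<close> in \<open>B\<close> that exceeds \<open>4 ^ n\<close> times the earlier sum by
  more than \<open>\<epsilon>\<close> in \<open>\<rho>\<close>, against the gliding hump.\<close>

lemma approximately_order_bounded:
  assumes B: "disjointly_null B" "\<And>y b. 0 \<le> y \<Longrightarrow> y \<le> b \<Longrightarrow> b \<in> B \<Longrightarrow> y \<in> B"
    and bdd: "\<And>b. b \<in> B \<Longrightarrow> norm b \<le> C" and \<epsilon>: "0 < \<epsilon>"
  shows "\<exists>N x. (\<forall>k<N. 0 \<le> x k \<and> x k \<in> B) \<and>
    (\<forall>b\<in>B. 0 \<le> b \<longrightarrow> \<rho> (pprt (b - 4 ^ N *\<^sub>R (\<Sum>k<N. x k))) \<le> \<epsilon>)"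
proof (rule ccontr)
  assume neg: "\<not> ?thesis"
  define P where "P = (\<lambda>(x::nat \<Rightarrow> 'a) n b. 0 \<le> b \<and> b \<in> B \<and>
    \<epsilon> < \<rho> (pprt (b - 4 ^ n *\<^sub>R (\<Sum>k<n. x k))))"
  have "\<exists>x. \<forall>n. P x n (x n)"
  proof (rule dependent_wf_choice[of less_than P])
    fix x y :: "nat \<Rightarrow> 'a" and n b
    assume "\<And>z. (z, n) \<in> less_than \<Longrightarrow> x z = y z"
    then have "(\<Sum>k<n. x k) = (\<Sum>k<n. y k)" by (intro sum.cong) auto
    then show "P x n b = P y n b" by (simp add: P_def)
  next
    fix x n
    assume x: "\<And>k. (k, n) \<in> less_than \<Longrightarrow> P x k (x k)"
    show "\<exists>b. P x n b"
    proof (rule ccontr)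
      assume *: "\<not> (\<exists>b. P x n b)"
      have "\<rho> (pprt (b - 4 ^ n *\<^sub>R (\<Sum>k<n. x k))) \<le> \<epsilon>" if "b \<in> B" "0 \<le> b" for b
        using * that by (auto simp: P_def not_less)
      moreover have "0 \<le> x k \<and> x k \<in> B" if "k < n" for k
        using x[of k] that by (simp add: P_def)
      ultimately show False using neg by blast
    qed
  qed (rule wf_less_than)
  then obtain x where x: "\<And>n. P x n (x n)" by (metis (no_types, lifting))
  have "(\<lambda>n. \<rho> (pprt (x n - 4 ^ n *\<^sub>R (\<Sum>k<n. x k)))) \<longlonglongrightarrow> 0"
    by (rule tendsto_0_of_disjointly_null[of B x C]) (use x bdd B in \<open>auto simp: P_def\<close>)
  then have "\<epsilon> \<le> 0"
    by (rule tendsto_lowerbound) (use x in \<open>auto simp: P_def less_imp_le\<close>)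
  then show False using \<epsilon> by simp
qed

theorem functionals_tendsto_0:
  fixes f :: "nat \<Rightarrow> 'a \<Rightarrow>\<^sub>L real"
  assumes B: "disjointly_null B" "\<And>y b. 0 \<le> y \<Longrightarrow> y \<le> b \<Longrightarrow> b \<in> B \<Longrightarrow> y \<in> B"
    and bdd: "\<And>b. b \<in> B \<Longrightarrow> norm b \<le> C"
    and f: "\<And>n. 0 \<le> f n" "\<And>n x. 0 \<le> x \<Longrightarrow> blinfun_apply (f n) x \<le> \<rho> x"
    and inf: "\<And>j x. 0 \<le> x \<Longrightarrow> (\<lambda>n. blinfun_apply (inf (f n) (f j)) x) \<longlonglongrightarrow> 0"
    and b: "\<And>n. 0 \<le> b n" "\<And>n. b n \<in> B"
  shows "(\<lambda>n. blinfun_apply (f n) (b n)) \<longlonglongrightarrow> 0"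
proof (rule LIMSEQ_I)
  fix \<epsilon> :: real assume "0 < \<epsilon>"
  then have \<epsilon>2: "0 < \<epsilon> / 2" by simp
  obtain N x where x: "\<forall>k<N. 0 \<le> x k \<and> x k \<in> B"
    and \<rho>: "\<forall>b\<in>B. 0 \<le> b \<longrightarrow> \<rho> (pprt (b - 4 ^ N *\<^sub>R (\<Sum>k<N. x k))) \<le> \<epsilon> / 2"
    using approximately_order_bounded[of B C "\<epsilon> / 2"] B bdd \<epsilon>2 by metis
  define u where "u = 4 ^ N *\<^sub>R (\<Sum>k<N. x k)"
  \<comment> \<open>Each \<open>x k\<close> is treated separately: \<open>{0..x k}\<close> lies in
    \<open>B\<close>, whereas \<open>{0..u}\<close> need not.\<close>
  have "(\<lambda>n. blinfun_apply (f n) (x k)) \<longlonglongrightarrow> 0" if "k < N" for k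
  proof (rule functional_tendsto_0)
    show "disjointly_null {0..x k}"
      by (rule disjointly_null_mono[OF B(1)]) (use B(2) x that in auto)
  qed (use x that f inf in auto)
  then have "(\<lambda>n. 4 ^ N * (\<Sum>k<N. blinfun_apply (f n) (x k))) \<longlonglongrightarrow> 0"
    by (intro tendsto_mult_right_zero tendsto_null_sum) auto
  then have "(\<lambda>n. blinfun_apply (f n) u) \<longlonglongrightarrow> 0"
    by (simp add: u_def blinfun.scaleR_right blinfun.sum_right)
  then have "\<forall>\<^sub>F n in sequentially. blinfun_apply (f n) u < \<epsilon> / 2"
    using \<epsilon>2 by (intro order_tendstoD(2))
  then obtain M where M: "\<And>n. M \<le> n \<Longrightarrow> blinfun_apply (f n) u < \<epsilon> / 2"
    unfolding eventually_sequentially by blast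
  show "\<exists>M. \<forall>n\<ge>M. norm (blinfun_apply (f n) (b n) - 0) < \<epsilon>"
  proof (intro exI allI impI)
    fix n assume n: "M \<le> n"
    have "blinfun_apply (f n) (b n) \<le> blinfun_apply (f n) (pprt (b n - u) + u)"
      using le_pprt[of "b n - u"] by (intro blinfun_mono f) (simp add: algebra_simps)
    also have "\<dots> = blinfun_apply (f n) (pprt (b n - u)) + blinfun_apply (f n) u"
      by (rule blinfun.add_right)
    also have "blinfun_apply (f n) (pprt (b n - u)) \<le> \<epsilon> / 2"
    proof -
      have "\<rho> (pprt (b n - u)) \<le> \<epsilon> / 2" unfolding u_def using \<rho> b by blast
      then show ?thesis using f(2)[of "pprt (b n - u)" n] by simp
    qed
    finally have "blinfun_apply (f n) (b n) < \<epsilon>" using M[OF n] by simp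
    then show "norm (blinfun_apply (f n) (b n) - 0) < \<epsilon>"
      using blinfun_nonneg[OF f(1) b(1), of n n] by simp
  qed
qed

end

section \<open>L-weakly compact sets and disjoint functionals\<close>

lemma cone_seminorm_SUP:
  fixes f :: "nat \<Rightarrow> 'a::banach_lattice \<Rightarrow>\<^sub>L real"
  assumes f: "\<And>n. 0 \<le> f n" "\<And>n. norm (f n) \<le> M"
  shows "cone_seminorm (\<lambda>x. SUP n. blinfun_apply (f n) x)"
    and "\<And>x. bdd_above (range (\<lambda>n. blinfun_apply (f n) x))"
    and "\<And>x. (SUP n. blinfun_apply (f n) x) \<le> M * norm x"
proof -
  have le: "blinfun_apply (f n) x \<le> M * norm x" for n x
    using norm_blinfun[of "f n" x] mult_right_mono[OF f(2)[of n] norm_ge_zero[of x]] by simp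
  show bdd: "bdd_above (range (\<lambda>n. blinfun_apply (f n) x))" for x by (rule bdd_aboveI2[OF le])
  show "(SUP n. blinfun_apply (f n) x) \<le> M * norm x" for x by (rule cSUP_least) (use le in auto)
  have up: "blinfun_apply (f n) x \<le> (SUP n. blinfun_apply (f n) x)" for n x
    by (rule cSUP_upper[OF UNIV_I bdd])
  show "cone_seminorm (\<lambda>x. SUP n. blinfun_apply (f n) x)"
  proof
    fix x y :: 'a and c :: real
    show "(SUP n. blinfun_apply (f n) x) \<le> (SUP n. blinfun_apply (f n) y)" if "x \<le> y"
      using blinfun_mono[OF f(1) that] up[of _ y] order_trans
      by (intro cSUP_least) (auto intro: order_trans)
    show "(SUP n. blinfun_apply (f n) (x + y))
        \<le> (SUP n. blinfun_apply (f n) x) + (SUP n. blinfun_apply (f n) y)"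
      by (intro cSUP_least) (auto simp: blinfun.add_right intro: add_mono up)
    show "(SUP n. blinfun_apply (f n) (c *\<^sub>R x)) = c * (SUP n. blinfun_apply (f n) x)" if "0 \<le> c"
    proof -
      have "c * (SUP n. blinfun_apply (f n) x) = (SUP y\<in>range (\<lambda>n. blinfun_apply (f n) x). c * y)"
        using that by (intro continuous_at_Sup_mono bdd)
          (auto intro!: monoI mult_left_mono continuous_intros)
      then show ?thesis by (simp add: blinfun.scaleR_right image_image)
    qed
  qed
qed

text \<open>The moduli of \<open>f n\<close> and \<open>a n\<close> reduce this to positive
  functionals on the solid hull of \<open>A\<close>. There \<open>\<rho>\<close> is at most a
  multiple of the norm, so disjoint sequences are \<open>\<rho>\<close>-null.\<close>

lemma L_weakly_compact_functionals_tendsto_0: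
  fixes A :: "'a::banach_lattice set" and f :: "nat \<Rightarrow> 'a \<Rightarrow>\<^sub>L real"
  assumes A: "L_weakly_compact A" and f: "bounded (range f)"
    and inf: "\<And>j x. 0 \<le> x \<Longrightarrow> (\<lambda>n. blinfun_apply (inf \<bar>f n\<bar> \<bar>f j\<bar>) x) \<longlonglongrightarrow> 0"
    and a: "\<And>n. a n \<in> A"
  shows "(\<lambda>n. blinfun_apply (f n) (a n)) \<longlonglongrightarrow> 0"
proof -
  obtain M where "\<And>n. norm (f n) \<le> M" using f by (auto simp: bounded_iff)
  then have M: "norm \<bar>f n\<bar> \<le> M" for n by simp
  obtain C where C: "\<And>a. a \<in> A \<Longrightarrow> norm a \<le> C" using A by (auto simp: L_weakly_compact_def bounded_iff)
  define \<rho> where "\<rho> x = (SUP n. blinfun_apply \<bar>f n\<bar> x)" for x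
  note sup = cone_seminorm_SUP[of "\<lambda>n. \<bar>f n\<bar>", OF abs_ge_zero M, folded \<rho>_def]
  interpret cone_seminorm \<rho> by (rule sup(1))
  have M0: "0 \<le> M" using M[of 0] norm_ge_zero order_trans by blast
  have "(\<lambda>n. blinfun_apply \<bar>f n\<bar> \<bar>a n\<bar>) \<longlonglongrightarrow> 0"
  proof (rule functionals_tendsto_0)
    show "disjointly_null (solid_hull A)"
      unfolding disjointly_null_def
    proof (intro allI impI)
      fix v :: "nat \<Rightarrow> 'a" assume v: "disjoint_seq v \<and> (\<forall>n. 0 \<le> v n \<and> v n \<in> solid_hull A)"
      then have "v \<longlonglongrightarrow> 0" using A by (auto simp: L_weakly_compact_def)
      then have lim: "(\<lambda>n. M * norm (v n)) \<longlonglongrightarrow> 0" by (simp add: tendsto_mult_right_zero tendsto_norm_zero)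
      show "(\<lambda>n. \<rho> (v n)) \<longlonglongrightarrow> 0"
        by (rule tendsto_sandwich[OF _ _ tendsto_const lim])
          (use v sup(3) in \<open>auto intro!: always_eventually nonneg\<close>)
    qed
    show "y \<in> solid_hull A" if "0 \<le> y" "y \<le> b" "b \<in> solid_hull A" for y b
    proof -
      obtain a where "a \<in> A" "\<bar>b\<bar> \<le> \<bar>a\<bar>" using \<open>b \<in> solid_hull A\<close> by (auto simp: solid_hull_def)
      moreover have "\<bar>y\<bar> \<le> \<bar>b\<bar>" using that(1,2) by (simp add: abs_of_nonneg)
      ultimately show ?thesis unfolding solid_hull_def using order_trans by blast
    qed
    show "norm b \<le> C" if "b \<in> solid_hull A" for b
    proof -
      obtain a where "a \<in> A" "\<bar>b\<bar> \<le> \<bar>a\<bar>" using \<open>b \<in> solid_hull A\<close> by (auto simp: solid_hull_def)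
      then show ?thesis using C norm_mono_abs order_trans by blast
    qed
    show "blinfun_apply \<bar>f n\<bar> x \<le> \<rho> x" for n x
      unfolding \<rho>_def by (rule cSUP_upper[OF UNIV_I sup(2)])
    show "\<bar>a n\<bar> \<in> solid_hull A" for n using a by (auto simp: solid_hull_def)
  qed (use inf in auto)
  then show ?thesis
    by (rule Lim_null_comparison[rotated]) (simp add: blinfun_abs_apply_le)
qed

text \<open>Each \<open>f n\<close> is at least \<open>\<epsilon> / 2\<close> at some
  \<open>b n\<close> in the positive unit ball. Since the \<open>f n\<close> are disjoint, this ball
  cannot be disjointly null for their supremum \<open>\<rho>\<close>; a disjoint sequence in it with
  \<open>\<rho>\<close> bounded below yields \<open>y\<close>, and \<open>k n\<close> names a
  functional that nearly attains the supremum.\<close>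

lemma disjoint_functionals_not_null:
  fixes f :: "nat \<Rightarrow> 'a::banach_lattice \<Rightarrow>\<^sub>L real"
  assumes f: "disjoint_seq f" "\<And>n. 0 \<le> f n" "bounded (range f)"
    and \<epsilon>: "0 < \<epsilon>" "\<And>n. \<epsilon> \<le> norm (f n)"
  obtains \<delta> y and k :: "nat \<Rightarrow> nat" where "0 < \<delta>" "disjoint_seq y" "\<And>n. 0 \<le> y n" "\<And>n. norm (y n) \<le> 1"
    "\<And>n. \<delta> \<le> blinfun_apply (f (k n)) (y n)"
proof -
  obtain M where M: "\<And>n. norm (f n) \<le> M" using f by (auto simp: bounded_iff)
  define \<rho> where "\<rho> x = (SUP n. blinfun_apply (f n) x)" for x
  note sup = cone_seminorm_SUP[of f, OF f(2) M, folded \<rho>_def]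
  interpret cone_seminorm \<rho> by (rule sup(1))
  define B where "B = {y::'a. 0 \<le> y \<and> norm y \<le> 1}"
  have "\<exists>b. b \<in> B \<and> \<epsilon> / 2 \<le> blinfun_apply (f n) b" for n
  proof -
    have "\<not> norm (f n) \<le> \<epsilon> / 2" using \<epsilon>(1) \<epsilon>(2)[of n] by linarith
    then have "\<not> (\<forall>x. norm (blinfun_apply (f n) x) \<le> \<epsilon> / 2 * norm x)"
      using norm_blinfun_bound[of "\<epsilon> / 2" "f n"] \<epsilon>(1) by auto
    then obtain x where x: "\<epsilon> / 2 * norm x < \<bar>blinfun_apply (f n) x\<bar>" by (auto simp: not_le)
    then have x0: "norm x > 0" by (cases "x = 0") auto
    have "\<bar>blinfun_apply (f n) x\<bar> \<le> blinfun_apply (f n) \<bar>x\<bar>"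
      using blinfun_abs_apply_le[of "f n" x] f(2)[of n] by simp
    then have "\<epsilon> / 2 \<le> blinfun_apply (f n) ((1 / norm x) *\<^sub>R \<bar>x\<bar>)"
      using x x0 by (simp add: blinfun.scaleR_right field_simps)
    moreover have "(1 / norm x) *\<^sub>R \<bar>x\<bar> \<in> B"
      using x0 by (simp add: B_def scaleR_nonneg_nonneg)
    ultimately show ?thesis by blast
  qed
  then obtain b where b: "\<And>n. b n \<in> B" "\<And>n. \<epsilon> / 2 \<le> blinfun_apply (f n) (b n)" by metis
  have "\<not> disjointly_null B"
  proof
    assume B: "disjointly_null B"
    have "(\<lambda>n. blinfun_apply (f n) (b n)) \<longlonglongrightarrow> 0"
    proof (rule functionals_tendsto_0[OF B])
      show "y \<in> B" if "0 \<le> y" "y \<le> z" "z \<in> B" for y z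
        using that norm_mono_nonneg[of y z] by (auto simp: B_def)
      show "norm z \<le> 1" if "z \<in> B" for z using that by (simp add: B_def)
      show "blinfun_apply (f n) x \<le> \<rho> x" for n x
        unfolding \<rho>_def by (rule cSUP_upper[OF UNIV_I sup(2)])
      show "(\<lambda>n. blinfun_apply (inf (f n) (f j)) x) \<longlonglongrightarrow> 0" for j x
      proof (rule tendsto_eventually, rule eventually_sequentiallyI[of "Suc j"])
        fix n assume "Suc j \<le> n"
        then have "inf (f n) (f j) = 0"
          using f(1) disjoint_seq_nonneg[of f] f(2) by (metis Suc_le_eq inf_commute)
        then show "blinfun_apply (inf (f n) (f j)) x = 0" by simp
      qed
      show "0 \<le> b n" for n using b(1)[of n] by (simp add: B_def)
    qed (use f b in auto)
    then have "\<epsilon> / 2 \<le> 0" by (rule tendsto_lowerbound) (use b in auto)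
    then show False using \<epsilon> by simp
  qed
  then obtain v where v: "disjoint_seq v" "\<And>n. 0 \<le> v n" "\<And>n. norm (v n) \<le> 1"
    and nv: "\<not> (\<lambda>n. \<rho> (v n)) \<longlonglongrightarrow> 0"
    unfolding disjointly_null_def B_def by blast
  obtain c r where c: "0 < c" and r: "strict_mono r" "\<And>n::nat. c \<le> \<rho> (v (r n))"
    using not_tendsto_0_subseq[OF nv nonneg[OF v(2)]] by blast
  have "\<exists>k. c / 2 \<le> blinfun_apply (f k) (v (r n))" for n
  proof -
    have "c / 2 < (SUP k. blinfun_apply (f k) (v (r n)))" using c r(2)[of n] by (simp add: \<rho>_def)
    then obtain k where "c / 2 < blinfun_apply (f k) (v (r n))"
      by (subst (asm) less_cSUP_iff[OF _ sup(2)]) auto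
    then show ?thesis by (intro exI[of _ k]) simp
  qed
  then obtain k where "\<And>n. c / 2 \<le> blinfun_apply (f (k n)) (v (r n))" by metis
  then show ?thesis
    using that[of "c / 2" "\<lambda>n. v (r n)" k] c v disjoint_seq_subseq[OF v(1) r(1)] by simp
qed

section \<open>Positive functionals\<close>

definition sublinear :: "('a::real_vector \<Rightarrow> real) \<Rightarrow> bool"
  where "sublinear p \<longleftrightarrow> (\<forall>x y. p (x + y) \<le> p x + p y) \<and> (\<forall>c\<ge>0. \<forall>x. p (c *\<^sub>R x) = c * p x)"

lemma sublinearI:
  fixes p :: "'a::real_vector \<Rightarrow> real"
  assumes add: "\<And>x y. p (x + y) \<le> p x + p y" and scale: "\<And>c x. 0 < c \<Longrightarrow> p (c *\<^sub>R x) \<le> c * p x"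
  shows "sublinear p"
proof -
  \<comment> \<open>Subadditivity gives \<open>0 \<le> p 0\<close>, and the scaling bound at
    \<open>1/2\<close> gives \<open>p 0 \<le> p 0 / 2\<close>.\<close>
  have "p 0 = 0" using add[of 0 0] scale[of "1/2" 0] by simp
  moreover have "p (c *\<^sub>R x) = c * p x" if c: "0 < c" for c x
  proof (rule antisym[OF scale[OF c]])
    have "p (inverse c *\<^sub>R (c *\<^sub>R x)) \<le> inverse c * p (c *\<^sub>R x)" using c by (intro scale) simp
    then show "c * p x \<le> p (c *\<^sub>R x)" using c by (simp add: field_simps)
  qed
  ultimately show ?thesis unfolding sublinear_def using add by (auto simp: le_less)
qed

lemma sublinear_neg_le: "sublinear p \<Longrightarrow> - p (- x) \<le> p x"
proof -
  assume p: "sublinear p"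
  have "p (0 *\<^sub>R x) = 0 * p x" using p unfolding sublinear_def by blast
  moreover have "p (x + - x) \<le> p x + p (- x)" using p unfolding sublinear_def by blast
  ultimately show ?thesis by simp
qed

text \<open>Lowers \<open>p\<close> along the direction \<open>a\<close>; a minimal sublinear functional is not
  lowered by this in any direction and is therefore additive.\<close>

definition sublinear_shift :: "'a::real_vector \<Rightarrow> ('a \<Rightarrow> real) \<Rightarrow> 'a \<Rightarrow> real"
  where "sublinear_shift a p x = (INF t\<in>{0..}. p (x + t *\<^sub>R a) - t * p a)"

lemma sublinear_shift:
  fixes p :: "'a::real_vector \<Rightarrow> real"
  assumes p: "sublinear p"
  shows "sublinear (sublinear_shift a p)"
    and "0 \<le> t \<Longrightarrow> sublinear_shift a p x \<le> p (x + t *\<^sub>R a) - t * p a"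
proof -
  have add: "p (x + y) \<le> p x + p y" and scale: "0 \<le> c \<Longrightarrow> p (c *\<^sub>R x) = c * p x" for c x y
    using p by (auto simp: sublinear_def)
  \<comment> \<open>This bound does not depend on \<open>t\<close>, so the infimum in
    \<open>sublinear_shift\<close> is taken over a set bounded below.\<close>
  have lower: "- p (- x) \<le> p (x + t *\<^sub>R a) - t * p a" if "0 \<le> t" for x t
    using add[of "x + t *\<^sub>R a" "- x"] scale[OF that, of a] by simp
  have upper: "sublinear_shift a p x \<le> p (x + t *\<^sub>R a) - t * p a" if "0 \<le> t" for x t
    unfolding sublinear_shift_def using that
    by (intro cINF_lower bdd_belowI2[where m = "- p (- x)"]) (auto intro: lower)
  then show "0 \<le> t \<Longrightarrow> sublinear_shift a p x \<le> p (x + t *\<^sub>R a) - t * p a" .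
  have greatest: "m \<le> sublinear_shift a p x" if "\<And>t. 0 \<le> t \<Longrightarrow> m \<le> p (x + t *\<^sub>R a) - t * p a" for m x
    unfolding sublinear_shift_def using that by (intro cINF_greatest) auto
  show "sublinear (sublinear_shift a p)"
  proof (rule sublinearI)
    fix x y
    have "sublinear_shift a p (x + y) - (p (y + t *\<^sub>R a) - t * p a) \<le> sublinear_shift a p x" if t: "0 \<le> t" for t
    proof (rule greatest)
      fix s :: real assume s: "0 \<le> s"
      have "sublinear_shift a p (x + y) \<le> p ((x + y) + (s + t) *\<^sub>R a) - (s + t) * p a"
        using s t by (intro upper) simp
      also have "(x + y) + (s + t) *\<^sub>R a = (x + s *\<^sub>R a) + (y + t *\<^sub>R a)" by (simp add: algebra_simps)
      finally show "sublinear_shift a p (x + y) - (p (y + t *\<^sub>R a) - t * p a) \<le> p (x + s *\<^sub>R a) - s * p a"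
        using add[of "x + s *\<^sub>R a" "y + t *\<^sub>R a"] by (simp add: algebra_simps)
    qed
    then have "sublinear_shift a p (x + y) - sublinear_shift a p x \<le> sublinear_shift a p y"
      by (intro greatest) (simp add: algebra_simps)
    then show "sublinear_shift a p (x + y) \<le> sublinear_shift a p x + sublinear_shift a p y" by simp
  next
    fix c :: real and x assume c: "0 < c"
    have "sublinear_shift a p (c *\<^sub>R x) / c \<le> sublinear_shift a p x"
    proof (rule greatest)
      fix t :: real assume t: "0 \<le> t"
      have "sublinear_shift a p (c *\<^sub>R x) \<le> p (c *\<^sub>R x + (c * t) *\<^sub>R a) - (c * t) * p a"
        using c t by (intro upper) simp
      also have "c *\<^sub>R x + (c * t) *\<^sub>R a = c *\<^sub>R (x + t *\<^sub>R a)" by (simp add: algebra_simps)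
      also have "p \<dots> = c * p (x + t *\<^sub>R a)" using c by (intro scale) simp
      finally show "sublinear_shift a p (c *\<^sub>R x) / c \<le> p (x + t *\<^sub>R a) - t * p a"
        using c by (simp add: field_simps)
    qed
    then show "sublinear_shift a p (c *\<^sub>R x) \<le> c * sublinear_shift a p x" using c by (simp add: field_simps)
  qed
qed

text \<open>Zorn's lemma in the reversed pointwise order. A nonempty chain is bounded by its
  pointwise infimum, which is finite because every sublinear \<open>q \<le> p\<close> satisfies
  \<open>- p (- x) \<le> q x\<close>.\<close>

lemma minimal_sublinear_exists:
  fixes p :: "'a::real_vector \<Rightarrow> real"
  assumes p: "sublinear p"
  obtains m where "sublinear m" "m \<le> p" "\<And>q. sublinear q \<Longrightarrow> q \<le> m \<Longrightarrow> q = m"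
proof -
  define A where "A = {q. sublinear q \<and> q \<le> p}"
  define R where "R = (\<lambda>f g :: 'a \<Rightarrow> real. g \<le> f)"
  have "\<exists>m\<in>A. \<forall>q\<in>A. R m q \<longrightarrow> q = m"
  proof (rule predicate_Zorn)
    show "partial_order_on A (relation_of R A)"
      by (rule partial_order_on_relation_ofI) (auto simp: R_def)
    fix C assume C: "C \<in> Chains (relation_of R A)"
    have CA: "q \<in> A" if "q \<in> C" for q using C that by (auto simp: Chains_def relation_of_def)
    have total: "q \<le> r \<or> r \<le> q" if "q \<in> C" "r \<in> C" for q r
      using C that by (auto simp: Chains_def relation_of_def R_def)
    show "\<exists>u\<in>A. \<forall>a\<in>C. R a u"
    proof (cases "C = {}")
      case True
      then show ?thesis using p by (auto simp: A_def)
    next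
      case False
      define u where "u x = (INF q\<in>C. q x)" for x
      have "- p (- x) \<le> q x" if "q \<in> C" for q x
      proof -
        have "sublinear q" "q (- x) \<le> p (- x)" using CA[OF that] by (auto simp: A_def le_fun_def)
        then show ?thesis using sublinear_neg_le[of q x] by simp
      qed
      then have upper: "u x \<le> q x" if "q \<in> C" for q x
        unfolding u_def using that by (intro cINF_lower bdd_belowI2[where m = "- p (- x)"]) auto
      have greatest: "b \<le> u x" if "\<And>q. q \<in> C \<Longrightarrow> b \<le> q x" for b x
        unfolding u_def using that False by (intro cINF_greatest) auto
      have "sublinear u"
      proof (rule sublinearI)
        fix x y
        \<comment> \<open>The smaller of \<open>q\<close> and \<open>r\<close> lies below both, so
          its subadditivity passes to the infimum.\<close>
        have "u (x + y) - r y \<le> u x" if r: "r \<in> C" for r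
        proof (rule greatest)
          fix q assume q: "q \<in> C"
          obtain s where s: "s \<in> C" "s \<le> q" "s \<le> r" using total[OF q r] q r by auto
          have "sublinear s" using CA[OF s(1)] by (simp add: A_def)
          then have "s (x + y) \<le> s x + s y" by (simp add: sublinear_def)
          then show "u (x + y) - r y \<le> q x"
            using upper[OF s(1), of "x + y"] le_funD[OF s(2), of x] le_funD[OF s(3), of y] by simp
        qed
        then have "u (x + y) - u x \<le> u y" by (intro greatest) (simp add: algebra_simps)
        then show "u (x + y) \<le> u x + u y" by simp
      next
        fix c :: real and x assume c: "0 < c"
        have "u (c *\<^sub>R x) / c \<le> u x"
        proof (rule greatest)
          fix q assume q: "q \<in> C"
          have "sublinear q" using CA[OF q] by (simp add: A_def)
          then have "q (c *\<^sub>R x) = c * q x" using c by (simp add: sublinear_def)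
          then show "u (c *\<^sub>R x) / c \<le> q x" using upper[OF q, of "c *\<^sub>R x"] c by (simp add: field_simps)
        qed
        then show "u (c *\<^sub>R x) \<le> c * u x" using c by (simp add: field_simps)
      qed
      moreover have "u \<le> p"
      proof -
        obtain q where q: "q \<in> C" using False by blast
        then show ?thesis using upper[OF q] CA[OF q] by (auto simp: A_def le_fun_def intro: order_trans)
      qed
      ultimately have "u \<in> A" by (simp add: A_def)
      then show ?thesis using upper by (auto simp: R_def le_fun_def)
    qed
  qed
  then obtain m where m: "m \<in> A" "\<And>q. q \<in> A \<Longrightarrow> q \<le> m \<Longrightarrow> q = m" by (auto simp: R_def)
  show ?thesis
  proof (rule that[of m])
    show "sublinear m" "m \<le> p" using m(1) by (auto simp: A_def)
    fix q assume "sublinear q" "q \<le> m"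
    then show "q = m" using m by (auto simp: A_def)
  qed
qed

text \<open>Take \<open>m\<close> minimal below \<open>sublinear_shift a p\<close>. Shifting
  \<open>m\<close> along any \<open>y\<close> changes nothing, so \<open>m\<close> is additive. The
  initial shift along \<open>a\<close> gives \<open>m (- a) \<le> - p a\<close>, which fixes the
  value at \<open>a\<close>.\<close>

theorem Hahn_Banach_sublinear:
  fixes p :: "'a::real_vector \<Rightarrow> real"
  assumes p: "sublinear p"
  obtains f where "linear f" "\<And>x. f x \<le> p x" "f a = p a"
proof -
  obtain m where m: "sublinear m" "m \<le> sublinear_shift a p" "\<And>q. sublinear q \<Longrightarrow> q \<le> m \<Longrightarrow> q = m"
    using minimal_sublinear_exists[OF sublinear_shift(1)[OF p, of a]] by blast
  have add: "m (x + y) \<le> m x + m y" and scale: "0 \<le> c \<Longrightarrow> m (c *\<^sub>R x) = c * m x" for c x y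
    using m(1) by (auto simp: sublinear_def)
  have "m (x + y) = m x + m y" for x y
  proof (rule antisym[OF add])
    have "sublinear_shift y m \<le> m"
      using sublinear_shift(2)[OF m(1), of 0] by (auto simp: le_fun_def)
    then have "sublinear_shift y m = m" using sublinear_shift(1)[OF m(1)] by (intro m(3))
    then have "m x \<le> m (x + 1 *\<^sub>R y) - 1 * m y" using sublinear_shift(2)[OF m(1), of 1 y x] by simp
    then show "m x + m y \<le> m (x + y)" by simp
  qed
  note add = this
  have m0: "m 0 = 0" using scale[of 0 0] by simp
  have neg: "m (- x) = - m x" for x using add[of x "- x"] m0 by simp
  have "linear m"
  proof (rule linearI)
    show "m (c *\<^sub>R x) = c *\<^sub>R m x" for c x
    proof (cases "0 \<le> c")
      case False
      then have "m ((- c) *\<^sub>R (- x)) = (- c) * m (- x)" by (intro scale) simp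
      then show ?thesis by (simp add: neg)
    qed (simp add: scale)
  qed (rule add)
  moreover have le: "m x \<le> p x" for x
    using le_funD[OF m(2), of x] sublinear_shift(2)[OF p, of 0 a x] by simp
  moreover have "m a = p a"
  proof (rule antisym[OF le])
    have "p (0 *\<^sub>R a) = 0 * p a" using p unfolding sublinear_def by blast
    then have "m (- a) \<le> - p a"
      using le_funD[OF m(2), of "- a"] sublinear_shift(2)[OF p, of 1 a "- a"] by simp
    then show "p a \<le> m a" by (simp add: neg)
  qed
  ultimately show ?thesis by (rule that)
qed

section \<open>Construction of functionals from the order structure\<close>

text \<open>The sublinear bound \<open>norm (pprt x)\<close> vanishes on negative elements, so a
  functional below it is positive; it is also at most \<open>norm x\<close> and agrees with it at
  \<open>v\<close>.\<close>

lemma positive_norming_functional: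
  fixes v :: "'a::banach_lattice"
  assumes v: "0 \<le> v"
  obtains f :: "'a \<Rightarrow>\<^sub>L real" where "0 \<le> f" "norm f \<le> 1" "blinfun_apply f v = norm v"
proof -
  have "sublinear (\<lambda>x::'a. norm (pprt x))"
  proof (rule sublinearI)
    fix x y :: 'a
    have "pprt (x + y) \<le> pprt (pprt x + pprt y)" by (intro pprt_mono add_mono le_pprt)
    then have "norm (pprt (x + y)) \<le> norm (pprt x + pprt y)" by (intro norm_mono_nonneg) auto
    also have "\<dots> \<le> norm (pprt x) + norm (pprt y)" by (rule norm_triangle_ineq)
    finally show "norm (pprt (x + y)) \<le> norm (pprt x) + norm (pprt y)" .
  qed (simp add: scaleR_pprt)
  then obtain g where g: "linear g" "\<And>x. g x \<le> norm (pprt x)" "g v = norm (pprt v)"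
    by (rule Hahn_Banach_sublinear) blast
  have abs: "norm (g x) \<le> norm x * 1" for x
  proof -
    have "g x \<le> norm x" using g(2)[of x] norm_pprt_le[of x] by simp
    moreover have "- g x \<le> norm x"
      using g(2)[of "- x"] norm_pprt_le[of "- x"] linear_neg[OF g(1), of x] by simp
    ultimately show ?thesis by simp
  qed
  have bl: "bounded_linear g"
    by (rule bounded_linear_intro[OF linear_add[OF g(1)] linear_scale[OF g(1)] abs])
  note G = bounded_linear_Blinfun_apply[OF bl]
  show ?thesis
  proof (rule that[of "Blinfun g"])
    have "0 \<le> g x" if "0 \<le> x" for x
    proof -
      have "pprt (- x) = 0" using that by (intro pprt_eq_0) simp
      then show ?thesis using g(2)[of "- x"] linear_neg[OF g(1), of x] by simp
    qed
    then show "0 \<le> Blinfun g" by (simp add: less_eq_blinfun_def G)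
    show "norm (Blinfun g) \<le> 1" using abs by (intro norm_blinfun_bound) (auto simp: G)
    show "blinfun_apply (Blinfun g) v = norm v" using g(3) v by (simp add: G)
  qed
qed

text \<open>Suprema, infima and series of functionals are formed pointwise on the cone below; this
  turns them into bounded functionals.\<close>

lemma blinfun_of_cone:
  fixes p :: "'a::banach_lattice \<Rightarrow> real"
  assumes add: "\<And>x y. 0 \<le> x \<Longrightarrow> 0 \<le> y \<Longrightarrow> p (x + y) = p x + p y"
    and scale: "\<And>c x. 0 < c \<Longrightarrow> 0 \<le> x \<Longrightarrow> p (c *\<^sub>R x) \<le> c * p x"
    and bound: "\<And>x. 0 \<le> x \<Longrightarrow> \<bar>p x\<bar> \<le> C * norm x"
  obtains f :: "'a \<Rightarrow>\<^sub>L real" where "\<And>x. 0 \<le> x \<Longrightarrow> blinfun_apply f x = p x"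
proof -
  have p0: "p 0 = 0" using bound[of 0] by simp
  have scale': "p (c *\<^sub>R x) = c *\<^sub>R p x" if c: "0 \<le> c" and x: "0 \<le> x" for c x
  proof (cases "c = 0")
    case False
    then have c: "0 < c" using c by simp
    have "p (inverse c *\<^sub>R (c *\<^sub>R x)) \<le> inverse c * p (c *\<^sub>R x)"
      using c x by (intro scale scaleR_nonneg_nonneg) auto
    then have "c * p x \<le> p (c *\<^sub>R x)" using c by (simp add: field_simps)
    then show ?thesis using scale[OF c x] by simp
  qed (simp add: p0)
  define P where "P = (\<lambda>x. p (pprt x) - p (- nprt x))"
  have "linear P" unfolding P_def by (rule linear_cone_extension[OF add scale'])
  have C: "0 \<le> C * norm x" if "0 \<le> x" for x :: 'a using bound[OF that] by simp
  have "norm (P x) \<le> norm x * (2 * \<bar>C\<bar>)" for x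
  proof -
    have b: "\<bar>p y\<bar> \<le> \<bar>C\<bar> * norm x" if "0 \<le> y" "norm y \<le> norm x" for y
    proof -
      have "C * norm y \<le> \<bar>C\<bar> * norm x" using that by (intro mult_mono) auto
      then show ?thesis using bound[OF that(1)] by simp
    qed
    have "\<bar>p (pprt x)\<bar> \<le> \<bar>C\<bar> * norm x" "\<bar>p (- nprt x)\<bar> \<le> \<bar>C\<bar> * norm x"
      by (rule b; simp add: norm_pprt_le norm_nprt_le)+
    then show ?thesis by (simp add: P_def algebra_simps)
  qed
  then have "bounded_linear P"
    using \<open>linear P\<close> by (intro bounded_linear.intro) (auto simp: bounded_linear_axioms_def)
  then have "blinfun_apply (Blinfun P) x = p x" if "0 \<le> x" for x
    using that by (simp add: bounded_linear_Blinfun_apply P_def p0)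
  then show ?thesis by (rule that)
qed

text \<open>Restriction of \<open>f\<close> to the band generated by \<open>c\<close>.\<close>

lemma functional_restrict:
  fixes f :: "'a::banach_lattice \<Rightarrow>\<^sub>L real"
  assumes f: "0 \<le> f" and c: "0 \<le> c"
  obtains g where "0 \<le> g" "g \<le> f" "blinfun_apply g c = blinfun_apply f c"
    "\<And>d. 0 \<le> d \<Longrightarrow> inf c d = 0 \<Longrightarrow> blinfun_apply g d = 0"
proof -
  \<comment> \<open>The elements \<open>inf x (k c)\<close> stand in for the band projection of
    \<open>x\<close>, which need not exist.\<close>
  define p where "p x = (SUP k\<in>{0..}. blinfun_apply f (inf x (k *\<^sub>R c)))" for x
  have upper: "blinfun_apply f (inf x (k *\<^sub>R c)) \<le> p x" if "0 \<le> k" for x k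
    unfolding p_def using that
    by (intro cSUP_upper bdd_aboveI2[where M = "blinfun_apply f x"]) (auto intro: blinfun_mono f)
  have least: "p x \<le> b" if "\<And>k. 0 \<le> k \<Longrightarrow> blinfun_apply f (inf x (k *\<^sub>R c)) \<le> b" for x b
    unfolding p_def using that by (intro cSUP_least) auto
  have kc: "0 \<le> k *\<^sub>R c" if "0 \<le> k" for k using that c by (rule scaleR_nonneg_nonneg)
  have p_le: "p x \<le> blinfun_apply f x" for x by (intro least blinfun_mono f) simp
  have p0: "0 \<le> p x" if "0 \<le> x" for x
    using upper[of 0 x] that by (simp add: inf_absorb2 blinfun.zero_right)
  obtain g where g: "\<And>x. 0 \<le> x \<Longrightarrow> blinfun_apply g x = p x"
  proof (rule blinfun_of_cone[of p "norm f"])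
    fix x y :: 'a assume xy: "0 \<le> x" "0 \<le> y"
    show "p (x + y) = p x + p y"
    proof (rule antisym)
      show "p (x + y) \<le> p x + p y"
      proof (rule least)
        fix k :: real assume k: "0 \<le> k"
        have "inf (x + y) (k *\<^sub>R c) \<le> inf x (k *\<^sub>R c) + inf y (k *\<^sub>R c)"
          using inf_add_le[OF kc[OF k] xy] by (simp add: inf_commute)
        then have "blinfun_apply f (inf (x + y) (k *\<^sub>R c))
            \<le> blinfun_apply f (inf x (k *\<^sub>R c)) + blinfun_apply f (inf y (k *\<^sub>R c))"
          by (metis blinfun_mono[OF f] blinfun.add_right)
        then show "blinfun_apply f (inf (x + y) (k *\<^sub>R c)) \<le> p x + p y"
          using upper[OF k, of x] upper[OF k, of y] by simp
      qed
      have "p x \<le> p (x + y) - blinfun_apply f (inf y (l *\<^sub>R c))" if l: "0 \<le> l" for l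
      proof (rule least)
        fix k :: real assume k: "0 \<le> k"
        have "inf x (k *\<^sub>R c) + inf y (l *\<^sub>R c) \<le> inf (x + y) ((k + l) *\<^sub>R c)"
          by (intro inf_greatest) (auto simp: scaleR_left_distrib intro: add_mono)
        then have "blinfun_apply f (inf x (k *\<^sub>R c)) + blinfun_apply f (inf y (l *\<^sub>R c))
            \<le> blinfun_apply f (inf (x + y) ((k + l) *\<^sub>R c))"
          by (metis blinfun_mono[OF f] blinfun.add_right)
        then show "blinfun_apply f (inf x (k *\<^sub>R c)) \<le> p (x + y) - blinfun_apply f (inf y (l *\<^sub>R c))"
          using upper[of "k + l" "x + y"] k l by simp
      qed
      then have "p y \<le> p (x + y) - p x" by (intro least) (simp add: algebra_simps)
      then show "p x + p y \<le> p (x + y)" by simp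
    qed
  next
    fix t :: real and x :: 'a assume t: "0 < t" and x: "0 \<le> x"
    show "p (t *\<^sub>R x) \<le> t * p x"
    proof (rule least)
      fix k :: real assume k: "0 \<le> k"
      have "inf (t *\<^sub>R x) (k *\<^sub>R c) = t *\<^sub>R inf x ((k / t) *\<^sub>R c)"
        using t by (simp add: scaleR_inf)
      then show "blinfun_apply f (inf (t *\<^sub>R x) (k *\<^sub>R c)) \<le> t * p x"
        using upper[of "k / t" x] t k by (simp add: blinfun.scaleR_right)
    qed
  next
    fix x :: 'a assume x: "0 \<le> x"
    then have "\<bar>p x\<bar> \<le> blinfun_apply f x" using p_le p0 by simp
    also have "\<dots> \<le> norm f * norm x" using norm_blinfun[of f x] by simp
    finally show "\<bar>p x\<bar> \<le> norm f * norm x" .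
  qed blast
  show ?thesis
  proof (rule that[of g])
    show "0 \<le> g" "g \<le> f" using p0 p_le by (auto simp: less_eq_blinfun_def g)
    show "blinfun_apply g c = blinfun_apply f c"
      using upper[of 1 c] p_le[of c] by (simp add: g[OF c])
    fix d assume d: "0 \<le> d" "inf c d = 0"
    have "p d \<le> 0"
    proof (rule least)
      fix k :: real assume k: "0 \<le> k"
      have "inf d (k *\<^sub>R c) = 0"
        using inf_scaleR_eq_0[OF d(1) c _ k] d(2) by (simp add: inf_commute)
      then show "blinfun_apply f (inf d (k *\<^sub>R c)) \<le> 0" by (simp add: blinfun.zero_right)
    qed
    then show "blinfun_apply g d = 0" using p0[OF d(1)] g[OF d(1)] by simp
  qed
qed

section \<open>The canonical embedding into the bidual\<close>

definition bidual :: "'a::real_normed_vector \<Rightarrow> ('a \<Rightarrow>\<^sub>L real) \<Rightarrow>\<^sub>L real"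
  where "bidual x = Blinfun (\<lambda>f. blinfun_apply f x)"

lemma bidual_apply [simp]: "blinfun_apply (bidual x) f = blinfun_apply f x"
  unfolding bidual_def by (simp add: bounded_linear_Blinfun_apply blinfun.bounded_linear_left)

lemma bidual_0 [simp]: "bidual 0 = 0"
  by (rule blinfun_eqI) simp

lemma bidual_minus: "bidual (- x) = - bidual x"
  by (rule blinfun_eqI) (simp add: blinfun.minus_left blinfun.minus_right)

lemma norm_bidual_le: "norm (bidual x) \<le> norm x"
proof (rule norm_blinfun_bound)
  show "norm (blinfun_apply (bidual x) f) \<le> norm x * norm f" for f
    using norm_blinfun[of f x] by (simp add: mult.commute)
qed simp

lemma bidual_mono: "x \<le> y \<Longrightarrow> bidual x \<le> bidual y" for x y :: "'a::banach_lattice"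
  by (auto simp: less_eq_blinfun_def[of "bidual x"] blinfun_mono)

text \<open>For the nontrivial inequality, let \<open>g\<close> be the restriction of
  \<open>f\<close> to the band of \<open>pprt (x - y)\<close>. Evaluating \<open>x\<close> at
  \<open>f - g\<close> and \<open>y\<close> at \<open>g\<close> gives
  \<open>f x - f (pprt (x - y))\<close>, which is the value of \<open>f\<close> at
  \<open>inf x y\<close>.\<close>

lemma bidual_inf: "bidual (inf x y) = inf (bidual x) (bidual y)" for x y :: "'a::banach_lattice"
proof (rule antisym)
  show "bidual (inf x y) \<le> inf (bidual x) (bidual y)" by (intro inf_greatest bidual_mono) auto
  show "inf (bidual x) (bidual y) \<le> bidual (inf x y)"
    unfolding less_eq_blinfun_def[of "inf (bidual x) (bidual y)"]
  proof (intro allI impI)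
    fix f :: "'a \<Rightarrow>\<^sub>L real" assume f: "0 \<le> f"
    define c where "c = pprt (x - y)"
    obtain g where g: "0 \<le> g" "g \<le> f" "blinfun_apply g c = blinfun_apply f c"
      "\<And>d. 0 \<le> d \<Longrightarrow> inf c d = 0 \<Longrightarrow> blinfun_apply g d = 0"
      using functional_restrict[OF f, of c] unfolding c_def by auto
    have "blinfun_apply g (pprt (- (x - y))) = 0"
      using inf_pprt_minus[of "x - y"] by (intro g(4)) (auto simp: c_def)
    then have gxy: "blinfun_apply g (x - y) = blinfun_apply f c"
      using prts[of "x - y"] g(3) unfolding c_def pprt_neg
      by (metis add_0_right blinfun.add_right blinfun.minus_right neg_equal_0_iff_equal)
    have "blinfun_apply (inf (bidual x) (bidual y)) ((f - g) + g)
        \<le> blinfun_apply (bidual x) (f - g) + blinfun_apply (bidual y) g"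
      unfolding blinfun.add_right using g(1,2)
      by (intro add_mono blinfun_apply_mono) auto
    also have "\<dots> = blinfun_apply f x - blinfun_apply g (x - y)"
      by (simp add: blinfun.diff_left blinfun.diff_right)
    also have "\<dots> = blinfun_apply f (x - pprt (x - y))"
      unfolding gxy by (simp add: c_def blinfun.diff_right)
    also have "x - pprt (x - y) = inf x y"
      using diff_inf_eq_pprt[of x y] by (simp add: algebra_simps del: diff_inf_eq_sup)
    finally show "blinfun_apply (inf (bidual x) (bidual y)) f \<le> blinfun_apply (bidual (inf x y)) f"
      by simp
  qed
qed

lemma bidual_abs: "bidual \<bar>x\<bar> = \<bar>bidual x\<bar>" for x :: "'a::banach_lattice"
proof -
  have "\<bar>x\<bar> = - inf (- x) x" by (simp add: abs_lattice sup_commute)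
  then have "bidual \<bar>x\<bar> = - inf (- bidual x) (bidual x)"
    by (simp only: bidual_minus bidual_inf)
  also have "\<dots> = \<bar>bidual x\<bar>" by (simp add: abs_lattice sup_commute)
  finally show ?thesis .
qed

lemma norm_bidual: "norm (bidual x) = norm x" for x :: "'a::banach_lattice"
proof (rule antisym[OF norm_bidual_le])
  obtain f :: "'a \<Rightarrow>\<^sub>L real" where f: "norm f \<le> 1" "blinfun_apply f \<bar>x\<bar> = norm \<bar>x\<bar>"
    using positive_norming_functional[of "\<bar>x\<bar>"] by auto
  have "norm x = \<bar>blinfun_apply (bidual \<bar>x\<bar>) f\<bar>" using f(2) by simp
  also have "\<dots> \<le> norm (bidual \<bar>x\<bar>) * norm f"
    using norm_blinfun[of "bidual \<bar>x\<bar>" f] unfolding real_norm_def .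
  also have "\<dots> \<le> norm (bidual \<bar>x\<bar>) * 1" using f(1) by (intro mult_left_mono) auto
  finally show "norm x \<le> norm (bidual x)" by (simp add: bidual_abs)
qed

section \<open>Disjoint sequences and unbounded convergence\<close>

lemma disjoint_seq_inf:
  assumes "disjoint_seq y" "0 \<le> u"
  shows "disjoint_seq (\<lambda>n. inf \<bar>y n\<bar> u)"
  using assms(1) by (rule disjoint_seq_mono) (use assms(2) in \<open>simp add: abs_of_nonneg\<close>)

lemma disjoint_seq_summable:
  fixes f :: "'a::banach_lattice \<Rightarrow>\<^sub>L real"
  assumes d: "disjoint_seq d" "\<And>n. 0 \<le> d n" "\<And>n. d n \<le> u" and f: "0 \<le> f"
  shows "summable (\<lambda>n. blinfun_apply f (d n))"
proof (rule summableI_nonneg_bounded)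
  show "0 \<le> blinfun_apply f (d n)" for n using f d(2) by (rule blinfun_nonneg)
  show "(\<Sum>n<N. blinfun_apply f (d n)) \<le> blinfun_apply f u" for N
    unfolding blinfun.sum_right[symmetric] by (intro blinfun_mono[OF f] disjoint_seq_sum_le d)
qed

text \<open>The truncations of \<open>\<bar>y n\<bar>\<close> by \<open>u\<close> are disjoint and
  below \<open>u\<close>, so \<open>\<bar>f\<bar>\<close> is summable along them.\<close>

lemma disjoint_seq_uaw_null:
  fixes y :: "nat \<Rightarrow> 'a::banach_lattice"
  assumes y: "disjoint_seq y"
  shows "uaw_null_seq y"
  unfolding uaw_convergent_def weakly_convergent_def
proof (intro allI impI)
  fix u :: 'a and f :: "'a \<Rightarrow>\<^sub>L real" assume u: "0 \<le> u"
  define d where "d n = inf \<bar>y n\<bar> u" for n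
  have d: "disjoint_seq d" "0 \<le> d n" "d n \<le> u" for n
    unfolding d_def using disjoint_seq_inf[OF y u] u by auto
  have "(\<lambda>n. blinfun_apply \<bar>f\<bar> (d n)) \<longlonglongrightarrow> 0"
    by (rule summable_LIMSEQ_zero[OF disjoint_seq_summable[OF d]]) simp
  then have "(\<lambda>n. blinfun_apply f (d n)) \<longlonglongrightarrow> 0"
  proof (rule Lim_null_comparison[OF always_eventually, rotated], intro allI)
    show "norm (blinfun_apply f (d n)) \<le> blinfun_apply \<bar>f\<bar> (d n)" for n
      using blinfun_abs_apply_le[of f "d n"] d(2)[of n] by (simp add: abs_of_nonneg)
  qed
  then show "(\<lambda>n. blinfun_apply f (inf \<bar>y n - 0\<bar> u)) \<longlonglongrightarrow> blinfun_apply f 0"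
    by (simp add: d_def blinfun.zero_right)
qed

text \<open>The tails of the order bounded disjoint series \<open>\<Sum>n. inf \<bar>y n\<bar> u\<close> decrease to \<open>0\<close>.\<close>

lemma disjoint_seq_uo_null:
  fixes y :: "nat \<Rightarrow> 'a::banach_lattice \<Rightarrow>\<^sub>L real"
  assumes y: "disjoint_seq y"
  shows "uo_null_seq y"
  unfolding uo_convergent_def
proof (intro allI impI)
  fix u :: "'a \<Rightarrow>\<^sub>L real" assume u: "0 \<le> u"
  define d where "d n = inf \<bar>y n\<bar> u" for n
  have d: "disjoint_seq d" "0 \<le> d n" "d n \<le> u" for n
    unfolding d_def using disjoint_seq_inf[OF y u] u by auto
  have sum_le: "(\<Sum>n<N. blinfun_apply (d n) x) \<le> blinfun_apply u x" if "0 \<le> x" for N x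
    unfolding blinfun.sum_left[symmetric] using that by (intro blinfun_apply_mono disjoint_seq_sum_le d)
  have nonneg: "0 \<le> blinfun_apply (d n) x" if "0 \<le> x" for n x using d(2) that by (rule blinfun_nonneg)
  have summable: "summable (\<lambda>n. blinfun_apply (d n) x)" if "0 \<le> x" for x
    using nonneg[OF that] sum_le[OF that] by (rule summableI_nonneg_bounded)
  \<comment> \<open>The order sum of the disjoint series can be defined pointwise on the cone, where
    the partial sums stay below \<open>u\<close>.\<close>
  obtain s where s: "\<And>x. 0 \<le> x \<Longrightarrow> blinfun_apply s x = (\<Sum>n. blinfun_apply (d n) x)"
  proof (rule blinfun_of_cone[of "\<lambda>x. \<Sum>n. blinfun_apply (d n) x" "norm u"])
    fix x :: 'a assume x: "0 \<le> x"
    have "\<bar>\<Sum>n. blinfun_apply (d n) x\<bar> = (\<Sum>n. blinfun_apply (d n) x)"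
      using suminf_nonneg[OF summable[OF x] nonneg[OF x]] by simp
    also have "\<dots> \<le> blinfun_apply u x" using summable[OF x] sum_le[OF x] by (rule suminf_le_const)
    also have "\<dots> \<le> norm u * norm x" using norm_blinfun[of u x] by simp
    finally show "\<bar>\<Sum>n. blinfun_apply (d n) x\<bar> \<le> norm u * norm x" .
  qed (auto simp: blinfun.add_right blinfun.scaleR_right suminf_add suminf_mult summable)
  define t where "t n = s - sum d {..<n}" for n
  have t: "blinfun_apply (t n) x = (\<Sum>k. blinfun_apply (d k) x) - (\<Sum>k<n. blinfun_apply (d k) x)"
    if "0 \<le> x" for n x
    by (simp add: t_def blinfun.diff_left blinfun.sum_left s that)
  have t0: "0 \<le> t n" for n
    unfolding less_eq_blinfun_def using sum_le_suminf[OF summable] nonneg by (auto simp: t)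
  have dec: "decreases_to_zero UNIV (\<le>) t"
    unfolding decreases_to_zero_def directed_index_def
  proof (intro conjI ballI allI impI)
    show "\<exists>k\<in>UNIV. i \<le> k \<and> j \<le> k" for i j :: nat by (intro bexI[of _ "max i j"]) auto
    show "t n \<le> t m" if "m \<le> n" for m n
      unfolding t_def using that d(2) by (intro diff_left_mono sum_mono2) auto
    fix z assume z: "\<forall>i\<in>UNIV. z \<le> t i"
    show "z \<le> 0" unfolding less_eq_blinfun_def
    proof (intro allI impI)
      fix x :: 'a assume x: "0 \<le> x"
      have "(\<lambda>n. blinfun_apply (t n) x) \<longlonglongrightarrow> (\<Sum>k. blinfun_apply (d k) x) - (\<Sum>k. blinfun_apply (d k) x)"
        unfolding t[OF x] by (intro tendsto_diff tendsto_const summable_LIMSEQ summable x)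
      then have "blinfun_apply z x \<le> (\<Sum>k. blinfun_apply (d k) x) - (\<Sum>k. blinfun_apply (d k) x)"
        by (rule tendsto_lowerbound) (use z x in \<open>auto intro!: always_eventually blinfun_apply_mono\<close>)
      then show "blinfun_apply z x \<le> blinfun_apply 0 x" by simp
    qed
  qed (auto intro: t0)
  \<comment> \<open>For \<open>n \<ge> m\<close> the element \<open>d n\<close> is one of the terms
    of the tail \<open>t m\<close>.\<close>
  have "d n \<le> t m" if "m \<le> n" for m n
  proof -
    have "t m = t (Suc n) + sum d {m..<Suc n}"
      using sum_diff_nat_ivl[of 0 m "Suc n" d] that by (simp add: t_def lessThan_atLeast0 algebra_simps)
    moreover have "d n \<le> sum d {m..<Suc n}" using that d(2) sum_mono2[of "{m..<Suc n}" "{n}" d] by auto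
    ultimately show ?thesis using t0[of "Suc n"] by (simp add: add_increasing)
  qed
  then have "\<forall>\<^sub>F n in sequentially. \<bar>d n - 0\<bar> \<le> t m" for m
    using d(2) by (intro eventually_sequentiallyI[of m]) (simp add: abs_of_nonneg)
  with dec have "order_convergent d 0 sequentially" by (rule order_convergentI)
  then show "order_convergent (\<lambda>n. inf \<bar>y n - 0\<bar> u) 0 sequentially" by (simp add: d_def[abs_def])
qed

section \<open>Comparison of the unbounded convergences in the dual\<close>

lemma uaw_null_imp_uaw_star_null:
  assumes "uaw_null_seq f"
  shows "uaw_star_null_seq f"
  unfolding uaw_star_convergent_def weak_star_convergent_def
proof (intro allI impI)
  fix u :: "'a \<Rightarrow>\<^sub>L real" and v assume "0 \<le> u"
  then have "(\<lambda>n. blinfun_apply (bidual v) (inf \<bar>f n - 0\<bar> u)) \<longlonglongrightarrow> blinfun_apply (bidual v) 0"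
    using assms unfolding uaw_convergent_def weakly_convergent_def by blast
  then show "(\<lambda>n. blinfun_apply (inf \<bar>f n - 0\<bar> u) v) \<longlonglongrightarrow> blinfun_apply 0 v" by simp
qed

text \<open>Directedness makes the pointwise infimum of the \<open>y j\<close> additive on the cone.
  It therefore defines a functional below every \<open>y j\<close>, hence below \<open>0\<close>,
  and so the values at \<open>v\<close> cannot stay above \<open>\<epsilon>\<close>.\<close>

lemma decreases_to_zero_apply:
  fixes y :: "'j \<Rightarrow> 'a::banach_lattice \<Rightarrow>\<^sub>L real"
  assumes y: "decreases_to_zero J r y" and v: "0 \<le> v" and \<epsilon>: "0 < \<epsilon>"
  obtains j where "j \<in> J" "blinfun_apply (y j) v < \<epsilon>"
proof -
  have dir: "\<exists>k\<in>J. r i k \<and> r j k" if "i \<in> J" "j \<in> J" for i j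
    using y that unfolding decreases_to_zero_def directed_index_def by meson
  have J: "J \<noteq> {}" using y by (simp add: decreases_to_zero_def directed_index_def)
  have anti: "y j \<le> y i" if "i \<in> J" "j \<in> J" "r i j" for i j
    using y that by (simp add: decreases_to_zero_def)
  have y0: "0 \<le> y i" if "i \<in> J" for i using y that by (simp add: decreases_to_zero_def)
  define p where "p x = (INF j\<in>J. blinfun_apply (y j) x)" for x
  have lower: "p x \<le> blinfun_apply (y j) x" if "0 \<le> x" "j \<in> J" for x j
    unfolding p_def using that
    by (intro cINF_lower bdd_belowI2[where m = 0]) (auto intro: blinfun_nonneg y0)
  have greatest: "b \<le> p x" if "\<And>j. j \<in> J \<Longrightarrow> b \<le> blinfun_apply (y j) x" for b x
    unfolding p_def using that J by (intro cINF_greatest) auto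
  obtain j0 where j0: "j0 \<in> J" using J by blast
  obtain h where h: "\<And>x. 0 \<le> x \<Longrightarrow> blinfun_apply h x = p x"
  proof (rule blinfun_of_cone[of p "norm (y j0)"])
    fix x z :: 'a assume x: "0 \<le> x" and z: "0 \<le> z"
    show "p (x + z) = p x + p z"
    proof (rule antisym)
      have "p (x + z) - blinfun_apply (y i) x \<le> p z" if i: "i \<in> J" for i
      proof (rule greatest)
        fix j assume j: "j \<in> J"
        obtain k where k: "k \<in> J" "r i k" "r j k" using dir[OF i j] by blast
        have "p (x + z) \<le> blinfun_apply (y k) x + blinfun_apply (y k) z"
          using lower[of "x + z" k] k x z by (simp add: blinfun.add_right)
        also have "\<dots> \<le> blinfun_apply (y i) x + blinfun_apply (y j) z"
          using anti i j k x z by (intro add_mono blinfun_apply_mono)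
        finally show "p (x + z) - blinfun_apply (y i) x \<le> blinfun_apply (y j) z" by simp
      qed
      then have "p (x + z) - p z \<le> p x" by (intro greatest) (simp add: algebra_simps)
      then show "p (x + z) \<le> p x + p z" by simp
      show "p x + p z \<le> p (x + z)"
        using x z by (intro greatest) (auto simp: blinfun.add_right intro: add_mono lower)
    qed
  next
    fix c :: real and x :: 'a assume c: "0 < c" and x: "0 \<le> x"
    have "p (c *\<^sub>R x) / c \<le> p x"
    proof (rule greatest)
      fix j assume "j \<in> J"
      then show "p (c *\<^sub>R x) / c \<le> blinfun_apply (y j) x"
        using lower[of "c *\<^sub>R x" j] c x by (simp add: blinfun.scaleR_right scaleR_nonneg_nonneg field_simps)
    qed
    then show "p (c *\<^sub>R x) \<le> c * p x" using c by (simp add: field_simps)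
  next
    fix x :: 'a assume x: "0 \<le> x"
    have "0 \<le> p x" using x by (intro greatest blinfun_nonneg y0)
    moreover have "p x \<le> norm (y j0) * norm x"
      using lower[OF x j0] norm_blinfun[of "y j0" x] by simp
    ultimately show "\<bar>p x\<bar> \<le> norm (y j0) * norm x" by simp
  qed blast
  have "\<forall>j\<in>J. h \<le> y j" using lower by (auto simp: less_eq_blinfun_def h)
  then have "h \<le> 0" using y by (simp add: decreases_to_zero_def)
  then have "p v < \<epsilon>" using v \<epsilon> h[OF v] blinfun_apply_mono[of h 0 v] by simp
  then have "\<not> (\<forall>j\<in>J. \<epsilon> \<le> blinfun_apply (y j) v)" using greatest[of \<epsilon> v] by auto
  then show ?thesis using that by (auto simp: not_le)
qed

text \<open>The dominating functionals become arbitrarily small at \<open>\<bar>v\<bar>\<close>,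
  which controls the values of the truncations at \<open>v\<close>.\<close>

lemma uo_null_imp_uaw_star_null:
  fixes f :: "nat \<Rightarrow> 'a::banach_lattice \<Rightarrow>\<^sub>L real"
  assumes "uo_null_seq f"
  shows "uaw_star_null_seq f"
  unfolding uaw_star_convergent_def weak_star_convergent_def
proof (intro allI impI)
  fix u :: "'a \<Rightarrow>\<^sub>L real" and v :: 'a assume "0 \<le> u"
  then have "order_convergent (\<lambda>n. inf \<bar>f n - 0\<bar> u) 0 sequentially"
    using assms by (simp add: uo_convergent_def)
  then obtain J :: "('a \<Rightarrow>\<^sub>L real) set" and r y where y: "decreases_to_zero J r y"
    and ev: "\<forall>j\<in>J. \<forall>\<^sub>F n in sequentially. \<bar>inf \<bar>f n - 0\<bar> u - 0\<bar> \<le> y j"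
    unfolding order_convergent_def by blast
  have "(\<lambda>n. blinfun_apply (inf \<bar>f n - 0\<bar> u) v) \<longlonglongrightarrow> 0"
  proof (rule tendstoI)
    fix \<epsilon> :: real assume "0 < \<epsilon>"
    then obtain j where j: "j \<in> J" "blinfun_apply (y j) \<bar>v\<bar> < \<epsilon>"
      using decreases_to_zero_apply[OF y, of "\<bar>v\<bar>" \<epsilon>] by auto
    show "\<forall>\<^sub>F n in sequentially. dist (blinfun_apply (inf \<bar>f n - 0\<bar> u) v) 0 < \<epsilon>"
      using bspec[OF ev j(1)]
    proof (rule eventually_mono)
      fix n assume n: "\<bar>inf \<bar>f n - 0\<bar> u - 0\<bar> \<le> y j"
      have "\<bar>blinfun_apply (inf \<bar>f n - 0\<bar> u) v\<bar> \<le> blinfun_apply \<bar>inf \<bar>f n - 0\<bar> u\<bar> \<bar>v\<bar>"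
        by (rule blinfun_abs_apply_le)
      also have "\<dots> \<le> blinfun_apply (y j) \<bar>v\<bar>" using n by (intro blinfun_apply_mono) auto
      finally show "dist (blinfun_apply (inf \<bar>f n - 0\<bar> u) v) 0 < \<epsilon>" using j(2) by simp
    qed
  qed
  then show "(\<lambda>n. blinfun_apply (inf \<bar>f n - 0\<bar> u) v) \<longlonglongrightarrow> blinfun_apply 0 v" by simp
qed

section \<open>L-weakly compact operators\<close>

lemma not_L_weakly_compact:
  fixes A :: "'a::banach_lattice set"
  assumes A: "bounded A" "\<not> L_weakly_compact A"
  obtains \<epsilon> v a where "0 < \<epsilon>" "disjoint_seq v" "\<And>n::nat. 0 \<le> v n" "\<And>n. v n \<le> \<bar>a n\<bar>"
    "\<And>n. a n \<in> A" "\<And>n. \<epsilon> \<le> norm (v n)"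
proof -
  obtain w where w: "disjoint_seq w" "range w \<subseteq> solid_hull A" "\<not> w \<longlonglongrightarrow> 0"
    using A unfolding L_weakly_compact_def by blast
  have "\<not> (\<lambda>n. norm (w n)) \<longlonglongrightarrow> 0" using w(3) tendsto_norm_zero_iff by blast
  then obtain \<epsilon> r where \<epsilon>: "0 < \<epsilon>" and r: "strict_mono r" "\<And>n::nat. \<epsilon> \<le> norm (w (r n))"
    using not_tendsto_0_subseq[of "\<lambda>n. norm (w n)"] by auto
  have "\<forall>n. \<exists>a\<in>A. \<bar>w (r n)\<bar> \<le> \<bar>a\<bar>" using w(2) by (auto simp: solid_hull_def)
  then obtain a where a: "\<And>n. a n \<in> A" "\<And>n. \<bar>w (r n)\<bar> \<le> \<bar>a n\<bar>" by metis
  have "disjoint_seq (\<lambda>n. \<bar>w (r n)\<bar>)"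
    by (rule disjoint_seq_mono[OF disjoint_seq_subseq[OF w(1) r(1)]]) simp
  then show ?thesis using that[of \<epsilon> "\<lambda>n. \<bar>w (r n)\<bar>" a] \<epsilon> a r(2) by simp
qed

text \<open>A disjoint sequence \<open>y\<close> on which the \<open>f (k n)\<close> stay above
  \<open>\<delta>\<close> also keeps \<open>\<bar>g (k n)\<bar>\<close> above
  \<open>\<delta>\<close>. By the Riesz-Kantorovich formula for the modulus, some \<open>z n\<close>
  with \<open>\<bar>z n\<bar> \<le> y n\<close> satisfies
  \<open>g (k n) (z n) \<ge> \<delta> / 2\<close>, and \<open>z\<close> inherits
  disjointness.\<close>

lemma disjoint_minorants_not_null:
  fixes f g :: "nat \<Rightarrow> 'a::banach_lattice \<Rightarrow>\<^sub>L real"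
  assumes f: "disjoint_seq f" "\<And>n. 0 \<le> f n" "\<And>n. f n \<le> \<bar>g n\<bar>" and g: "bounded (range g)"
    and \<epsilon>: "0 < \<epsilon>" "\<And>n. \<epsilon> \<le> norm (f n)"
  obtains z and k :: "nat \<Rightarrow> nat" where "disjoint_seq z" "bounded (range z)"
    "\<not> (\<lambda>n. blinfun_apply (g (k n)) (z n)) \<longlonglongrightarrow> 0"
proof -
  have "norm (f n) \<le> norm (g n)" for n using norm_mono_nonneg[OF f(2,3)] by simp
  then have "bounded (range f)" using g unfolding bounded_iff by (auto intro: order_trans)
  then obtain \<delta> y and k :: "nat \<Rightarrow> nat" where \<delta>: "0 < \<delta>" and y: "disjoint_seq y" "\<And>n. 0 \<le> y n"
    "\<And>n. norm (y n) \<le> 1" "\<And>n. \<delta> \<le> blinfun_apply (f (k n)) (y n)"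
    using disjoint_functionals_not_null[of f \<epsilon>] f(1,2) \<epsilon> by metis
  have "\<exists>z. \<bar>z\<bar> \<le> y n \<and> \<delta> / 2 \<le> blinfun_apply (g (k n)) z" for n
  proof (rule ccontr)
    assume *: "\<not> (\<exists>z. \<bar>z\<bar> \<le> y n \<and> \<delta> / 2 \<le> blinfun_apply (g (k n)) z)"
    have "blinfun_apply \<bar>g (k n)\<bar> (y n) \<le> \<delta> / 2"
      by (rule blinfun_abs_least[OF y(2)]) (use * in \<open>auto simp: not_le less_imp_le\<close>)
    moreover have "\<delta> \<le> blinfun_apply \<bar>g (k n)\<bar> (y n)"
      using y(4)[of n] blinfun_apply_mono[OF f(3) y(2), of "k n" n] by simp
    ultimately show False using \<delta> by simp
  qed
  then obtain z where z: "\<And>n. \<bar>z n\<bar> \<le> y n" "\<And>n. \<delta> / 2 \<le> blinfun_apply (g (k n)) (z n)"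
    by metis
  show ?thesis
  proof (rule that)
    show "disjoint_seq z"
      using y(1) by (rule disjoint_seq_mono) (use z(1) y(2) in \<open>simp add: abs_of_nonneg\<close>)
    have "norm (z n) \<le> 1" for n
      using norm_mono_abs[of "z n" "y n"] z(1)[of n] y(2)[of n] y(3)[of n] by (simp add: abs_of_nonneg)
    then show "bounded (range z)" unfolding bounded_iff by auto
    show "\<not> (\<lambda>n. blinfun_apply (g (k n)) (z n)) \<longlonglongrightarrow> 0"
    proof
      assume "(\<lambda>n. blinfun_apply (g (k n)) (z n)) \<longlonglongrightarrow> 0"
      then have "\<delta> / 2 \<le> 0" by (rule tendsto_lowerbound) (use z(2) in auto)
      then show False using \<delta> by simp
    qed
  qed
qed

lemma bounded_blinfun_image_cball: "bounded (blinfun_apply T ` cball 0 1)"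
  by (rule bounded_linear_image) (auto intro: blinfun.bounded_linear_right)

text \<open>Testing on disjoint \<open>y'\<close> serves all three kinds of null sequences at once.
  The embedding \<open>bidual\<close> preserves infima and norms, so a disjoint sequence below the
  \<open>\<bar>a n\<bar>\<close> becomes one of functionals on the dual, and the resulting
  \<open>z\<close> lies in the dual.\<close>

lemma L_weakly_compact_operatorI:
  fixes T :: "'e::banach \<Rightarrow>\<^sub>L 'f::banach_lattice"
  assumes T: "\<And>x (y' :: nat \<Rightarrow> 'f \<Rightarrow>\<^sub>L real). range x \<subseteq> cball 0 1 \<Longrightarrow> bounded (range y') \<Longrightarrow> disjoint_seq y' \<Longrightarrow>
    (\<lambda>n. blinfun_apply (y' n) (blinfun_apply T (x n))) \<longlonglongrightarrow> 0"
  shows "L_weakly_compact_operator T"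
proof (rule ccontr)
  let ?A = "blinfun_apply T ` cball 0 1"
  assume "\<not> ?thesis"
  then have "\<not> L_weakly_compact ?A" by (simp add: L_weakly_compact_operator_def)
  then obtain \<epsilon> v a where \<epsilon>: "0 < \<epsilon>" "\<And>n. \<epsilon> \<le> norm (v n)" and v: "disjoint_seq v" "\<And>n::nat. 0 \<le> v n"
    and a: "\<And>n. v n \<le> \<bar>a n\<bar>" "\<And>n. a n \<in> ?A"
    using not_L_weakly_compact[OF bounded_blinfun_image_cball, of T] by metis
  obtain z k where z: "disjoint_seq z" "bounded (range z)"
    "\<not> (\<lambda>n. blinfun_apply (bidual (a (k n))) (z n)) \<longlonglongrightarrow> 0"
  proof (rule disjoint_minorants_not_null[of "\<lambda>n. bidual (v n)" "\<lambda>n. bidual (a n)" \<epsilon>])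
    have v0: "0 \<le> bidual (v n)" for n using bidual_mono[OF v(2)[of n]] by simp
    then show "0 \<le> bidual (v n)" for n .
    have "inf (bidual (v m)) (bidual (v n)) = 0" if "m < n" for m n
      using v(1) that unfolding disjoint_seq_nonneg[of v, OF v(2)] bidual_inf[symmetric]
      by simp
    then show "disjoint_seq (\<lambda>n. bidual (v n))" by (simp add: disjoint_seq_nonneg v0)
    show "bidual (v n) \<le> \<bar>bidual (a n)\<bar>" for n
      unfolding bidual_abs[symmetric] by (intro bidual_mono a)
    show "bounded (range (\<lambda>n. bidual (a n)))"
    proof -
      obtain C where "\<And>b. b \<in> ?A \<Longrightarrow> norm b \<le> C"
        using bounded_blinfun_image_cball[of T] unfolding bounded_iff by blast
      then have "norm (bidual (a n)) \<le> C" for n using norm_bidual_le a(2) order_trans by blast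
      then show ?thesis unfolding bounded_iff by auto
    qed
    show "\<epsilon> \<le> norm (bidual (v n))" for n using \<epsilon> by (simp add: norm_bidual)
  qed (use \<epsilon> in auto)
  have "\<forall>n. \<exists>x\<in>cball 0 1. a (k n) = blinfun_apply T x" using a(2) by blast
  then obtain x where "\<And>n. x n \<in> cball 0 1" and x: "\<And>n. a (k n) = blinfun_apply T (x n)" by metis
  then have "range x \<subseteq> cball 0 1" by blast
  from T[OF this z(2,1)] show False using z(3) by (simp add: x)
qed

text \<open>The values of \<open>S\<close> already are functionals on \<open>'f\<close>, so the
  disjoint test sequence arises in \<open>'f\<close> itself, without the embedding.\<close>

lemma L_weakly_compact_operator_dualI:
  fixes S :: "'e::banach \<Rightarrow>\<^sub>L 'f::banach_lattice \<Rightarrow>\<^sub>L real"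
  assumes S: "\<And>x y. range x \<subseteq> cball 0 1 \<Longrightarrow> bounded (range y) \<Longrightarrow> disjoint_seq y \<Longrightarrow>
    (\<lambda>n. blinfun_apply (blinfun_apply S (x n)) (y n)) \<longlonglongrightarrow> 0"
  shows "L_weakly_compact_operator S"
proof (rule ccontr)
  let ?A = "blinfun_apply S ` cball 0 1"
  assume "\<not> ?thesis"
  then have "\<not> L_weakly_compact ?A" by (simp add: L_weakly_compact_operator_def)
  then obtain \<epsilon> v a where \<epsilon>: "0 < \<epsilon>" "\<And>n. \<epsilon> \<le> norm (v n)" and v: "disjoint_seq v" "\<And>n::nat. 0 \<le> v n"
    and a: "\<And>n. v n \<le> \<bar>a n\<bar>" "\<And>n. a n \<in> ?A"
    using not_L_weakly_compact[OF bounded_blinfun_image_cball, of S] by metis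
  have "bounded (range a)" by (rule bounded_subset[OF bounded_blinfun_image_cball[of S]]) (use a(2) in blast)
  then obtain z k where z: "disjoint_seq z" "bounded (range z)"
    "\<not> (\<lambda>n. blinfun_apply (a (k n)) (z n)) \<longlonglongrightarrow> 0"
    using disjoint_minorants_not_null[of v a \<epsilon>] v a(1) \<epsilon> by metis
  have "\<forall>n. \<exists>x\<in>cball 0 1. a (k n) = blinfun_apply S x" using a(2) by blast
  then obtain x where "\<And>n. x n \<in> cball 0 1" and x: "\<And>n. a (k n) = blinfun_apply S (x n)" by metis
  then have "range x \<subseteq> cball 0 1" by blast
  from S[OF this z(2,1)] show False using z(3) by (simp add: x)
qed

text \<open>Truncating by \<open>\<bar>y' j\<bar>\<close> in the unbounded convergence gives exactly
  the asymptotic disjointness asked of the functionals.\<close>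

lemma L_weakly_compact_operatorD:
  fixes T :: "'e::banach \<Rightarrow>\<^sub>L 'f::banach_lattice"
  assumes T: "L_weakly_compact_operator T" and x: "range x \<subseteq> cball 0 1"
    and y': "bounded (range y')" "uaw_star_null_seq y'"
  shows "(\<lambda>n. blinfun_apply (y' n) (blinfun_apply T (x n))) \<longlonglongrightarrow> 0"
proof (rule L_weakly_compact_functionals_tendsto_0[OF _ y'(1)])
  show "L_weakly_compact (blinfun_apply T ` cball 0 1)"
    using T by (simp add: L_weakly_compact_operator_def)
  show "blinfun_apply T (x n) \<in> blinfun_apply T ` cball 0 1" for n using x by blast
  fix j and v :: 'f
  have "weak_star_convergent (\<lambda>n. inf \<bar>y' n - 0\<bar> \<bar>y' j\<bar>) 0 sequentially"
    using y'(2) by (simp add: uaw_star_convergent_def)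
  then show "(\<lambda>n. blinfun_apply (inf \<bar>y' n\<bar> \<bar>y' j\<bar>) v) \<longlonglongrightarrow> 0"
    by (simp add: weak_star_convergent_def)
qed

text \<open>The \<open>y n\<close> act on the dual through \<open>bidual\<close>. As the embedding
  preserves infima and moduli, weak convergence of the truncations is pointwise convergence of the
  infima of the embedded functionals.\<close>

lemma L_weakly_compact_operator_dualD:
  fixes S :: "'e::banach \<Rightarrow>\<^sub>L 'f::banach_lattice \<Rightarrow>\<^sub>L real"
  assumes S: "L_weakly_compact_operator S" and x: "range x \<subseteq> cball 0 1"
    and y: "bounded (range y)" "uaw_null_seq y"
  shows "(\<lambda>n. blinfun_apply (blinfun_apply S (x n)) (y n)) \<longlonglongrightarrow> 0"
proof -
  have "(\<lambda>n. blinfun_apply (bidual (y n)) (blinfun_apply S (x n))) \<longlonglongrightarrow> 0"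
  proof (rule L_weakly_compact_functionals_tendsto_0)
    show "L_weakly_compact (blinfun_apply S ` cball 0 1)"
      using S by (simp add: L_weakly_compact_operator_def)
    show "blinfun_apply S (x n) \<in> blinfun_apply S ` cball 0 1" for n using x by blast
    obtain C where "\<And>n. norm (y n) \<le> C" using y(1) unfolding bounded_iff by blast
    then show "bounded (range (\<lambda>n. bidual (y n)))"
      unfolding bounded_iff by (auto simp: norm_bidual)
    fix j and f :: "'f \<Rightarrow>\<^sub>L real"
    have "weakly_convergent (\<lambda>n. inf \<bar>y n - 0\<bar> \<bar>y j\<bar>) 0 sequentially"
      using y(2) by (simp add: uaw_convergent_def)
    then have "(\<lambda>n. blinfun_apply f (inf \<bar>y n\<bar> \<bar>y j\<bar>)) \<longlonglongrightarrow> 0"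
      by (simp add: weakly_convergent_def blinfun.zero_right)
    then show "(\<lambda>n. blinfun_apply (inf \<bar>bidual (y n)\<bar> \<bar>bidual (y j)\<bar>) f) \<longlonglongrightarrow> 0"
      by (simp flip: bidual_abs bidual_inf)
  qed
  then show ?thesis by simp
qed

theorem theorem2p5:
  fixes T :: "'e::banach \<Rightarrow>\<^sub>L 'f::banach_lattice"
    and S :: "'e \<Rightarrow>\<^sub>L ('f \<Rightarrow>\<^sub>L real)"
  shows "(L_weakly_compact_operator T \<longleftrightarrow>
        (\<forall>(x :: nat \<Rightarrow> 'e) (y' :: nat \<Rightarrow> 'f \<Rightarrow>\<^sub>L real).
          range x \<subseteq> cball 0 1 \<and> bounded (range y') \<and> uaw_star_null_seq y' \<longrightarrow>
          (\<lambda>n. blinfun_apply (y' n) (blinfun_apply T (x n))) \<longlonglongrightarrow> 0)) \<and>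
     (L_weakly_compact_operator T \<longleftrightarrow>
        (\<forall>(x :: nat \<Rightarrow> 'e) (y' :: nat \<Rightarrow> 'f \<Rightarrow>\<^sub>L real).
          range x \<subseteq> cball 0 1 \<and> bounded (range y') \<and> uaw_null_seq y' \<longrightarrow>
          (\<lambda>n. blinfun_apply (y' n) (blinfun_apply T (x n))) \<longlonglongrightarrow> 0)) \<and>
     (L_weakly_compact_operator T \<longleftrightarrow>
        (\<forall>(x :: nat \<Rightarrow> 'e) (y' :: nat \<Rightarrow> 'f \<Rightarrow>\<^sub>L real).
          range x \<subseteq> cball 0 1 \<and> bounded (range y') \<and> uo_null_seq y' \<longrightarrow>
          (\<lambda>n. blinfun_apply (y' n) (blinfun_apply T (x n))) \<longlonglongrightarrow> 0)) \<and>
     (L_weakly_compact_operator S \<longleftrightarrow>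
        (\<forall>(x :: nat \<Rightarrow> 'e) (y :: nat \<Rightarrow> 'f).
          range x \<subseteq> cball 0 1 \<and> bounded (range y) \<and> uaw_null_seq y \<longrightarrow>
          (\<lambda>n. blinfun_apply (blinfun_apply S (x n)) (y n)) \<longlonglongrightarrow> 0))"
proof (intro conjI iffI)
\<comment> \<open>Forward, uaw-null and uo-null sequences in the dual are uaw-star-null. Backward,
  each condition covers disjoint sequences; for \<open>S\<close> these are uaw-null in
  \<open>'f\<close>.\<close>
qed (auto intro!: L_weakly_compact_operatorI L_weakly_compact_operator_dualI
      intro: L_weakly_compact_operatorD L_weakly_compact_operator_dualD
        disjoint_seq_uaw_null disjoint_seq_uo_null uaw_null_imp_uaw_star_null uo_null_imp_uaw_star_null)

end
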